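(* Let $E$ be an arbitrary directed graph and $K$ a field. Let $v\in E^0$ be an infinite emitter and suppose that $r(s^{-1}(v))\subseteq H(v)$. Then the annihilator in $L_K(E)$ of the simple left module $\mathbf N_v^{H(v)}$ is $I(H(v),B_{H(v)})$.
   Context: A directed graph $E=(E^0,E^1,r,s)$ consists of sets $E^0$ (vertices), $E^1$ (edges), of any cardinality, and maps $r,s:E^1\to E^0$. A vertex $v$ is a sink if $s^{-1}(v)=\emptyset$, regular if $s^{-1}(v)$ is finite and non-empty, an infinite emitter if $s^{-1}(v)$ is infinite. Vertices are paths of length $0$; $u\ge v$ means there is a path from $u$ to $v$. $L_K(E)$ (Leavitt path algebra) is the $K$-algebra generated by pairwise orthogonal idempotents $v\in E^0$ and elements $e,e^*$ ($e\in E^1$) with relations: $s(e)e=e=er(e)$; $r(e)e^*=e^*=e^*s(e)$; $e^*e=r(e)$ and $e^*f=0$ for $e\ne f$; $v=\sum_{s(e)=v}ee^*$ for every regular vertex $v$. $H(v)=E^0\setminus\{w\in E^0:w\ge v\}$; for $v$ an infinite emitter it is hereditary saturated (hereditary: $u\in H,u\ge u'$ imply $u'\in H$; saturated: a regular $u$ with $r(s^{-1}(u))\subseteq H$ lies in $H$). For a hereditary saturated $H$, $B_H$ is the set of infinite emitters $u\in E^0\setminus H$ with $1\le|s^{-1}(u)\cap r^{-1}(E^0\setminus H)|<\infty$; for $u\in B_H$, $u^H=u-\sum_{s(e)=u,\,r(e)\notin H}ee^*$; $I(H,B_H)$ is the two-sided ideal of $L_K(E)$ generated by $H\cup\{u^H:u\in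 B_H\}$. The quotient graph $E\backslash(H,B_H)$ is the subgraph with vertices $E^0\setminus H$ and edges $\{e\in E^1:r(e)\notin H\}$. There is a surjection $L_K(E)\to L_K(E\backslash(H,B_H))$ with kernel $I(H,B_H)$, sending vertices $u\in H$ and edges $e$ (and $e^*$) with $r(e)\in H$ to $0$ and every other generator to itself. For a sink $w$ of a graph $G$, $\mathbf N_w$ is the $K$-space with basis all finite paths in $G$ ending in $w$, with left $L_K(G)$-action on a basis path $q$: $u\cdot q=q$ if $u=s(q)$, else $0$; $e\cdot q=eq$ if $r(e)=s(q)$, else $0$; $e^*\cdot q=q'$ if $q=eq'$, else $0$ (so $e^*\cdot w=0$); it is simple. When $v$ is an infinite emitter with $r(s^{-1}(v))\subseteq H(v)$, $v$ is the unique sink of $G=E\backslash(H(v),B_{H(v)})$, and $\mathbf N_v^{H(v)}$ is the $L_K(G)$-module $\mathbf N_v$ viewed as an $L_K(E)$-module via the quotient map $L_K(E)\to L_K(G)$. *)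

theory Defs
  imports
    "HOL-Algebra.QuotRing"
    "HOL-Algebra.Module"
    "HOL-Library.Poly_Mapping"
    "Graph_Theory.Arc_Walk"
begin

section \<open>Linear algebra on finitely supported functions\<close>

definition pm_scale :: "'k::field \<Rightarrow> ('b \<Rightarrow>\<^sub>0 'k) \<Rightarrow> ('b \<Rightarrow>\<^sub>0 'k)" where
  "pm_scale c x = Poly_Mapping.map ((*) c) x"

text \<open>The \<open>K\<close>-linear extension of a map given on the basis.\<close>

definition lin_ext :: "('b \<Rightarrow> ('c \<Rightarrow>\<^sub>0 'k)) \<Rightarrow> ('b \<Rightarrow>\<^sub>0 'k::field) \<Rightarrow> ('c \<Rightarrow>\<^sub>0 'k)" where
  "lin_ext f x = (\<Sum>b\<in>Poly_Mapping.keys x. pm_scale (Poly_Mapping.lookup x b) (f b))"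

section \<open>Algebras without unit\<close>

text \<open>
  A Leavitt path algebra has a unit only if the graph has finitely many vertices. We store
  \<open>K\<close>-algebras in the library record \<open>module\<close> (carrier, ring operations and scalar
  multiplication), but the field \<open>one\<close> carries no meaning and is left undefined.
  Ideals of a \<open>K\<close>-algebra are two-sided and closed under scalars. In a Leavitt path algebra the
  latter is automatic, since \<open>c\<cdot>a = a(c\<cdot>u)\<close> for a suitable finite sum \<open>u\<close> of vertices.
\<close>

definition alg_ideal :: "('k, 'a, 'm) module_scheme \<Rightarrow> 'a set \<Rightarrow> bool" where
  "alg_ideal A I \<longleftrightarrow>
     I \<subseteq> carrier A \<and> \<zero>\<^bsub>A\<^esub> \<in> I \<and>
     (\<forall>x\<in>I. \<forall>y\<in>I. x \<oplus>\<^bsub>A\<^esub> y \<in> I) \<and>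
     (\<forall>c. \<forall>x\<in>I. c \<odot>\<^bsub>A\<^esub> x \<in> I) \<and>
     (\<forall>a\<in>carrier A. \<forall>x\<in>I. a \<otimes>\<^bsub>A\<^esub> x \<in> I \<and> x \<otimes>\<^bsub>A\<^esub> a \<in> I)"

definition alg_ideal_gen :: "('k, 'a, 'm) module_scheme \<Rightarrow> 'a set \<Rightarrow> 'a set" where
  "alg_ideal_gen A S = \<Inter>{I. alg_ideal A I \<and> S \<subseteq> I}"

definition alg_quot :: "('k, 'a, 'm) module_scheme \<Rightarrow> 'a set \<Rightarrow> ('k, 'a set) module" where
  "alg_quot A I =
     \<lparr>carrier = a_rcosets\<^bsub>A\<^esub> I, mult = rcoset_mult A I, one = undefined,
      zero = I, add = set_add A,
      smult = (\<lambda>c X. \<Union>x\<in>X. I +>\<^bsub>A\<^esub> (c \<odot>\<^bsub>A\<^esub> x))\<rparr>"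

text \<open>
  Left modules over such an algebra are also stored in the record \<open>module\<close>: the scalar
  multiplication is the action, and \<open>mult\<close>, \<open>one\<close> carry no meaning.
\<close>

definition annihilator :: "('k, 'a, 'm) module_scheme \<Rightarrow> ('a, 'n, 'l) module_scheme \<Rightarrow> 'a set" where
  "annihilator A N = {a \<in> carrier A. \<forall>x\<in>carrier N. a \<odot>\<^bsub>N\<^esub> x = \<zero>\<^bsub>N\<^esub>}"

section \<open>Free algebras\<close>

text \<open>
  \<open>'g word \<Rightarrow>\<^sub>0 'k\<close> is the free unital \<open>K\<close>-algebra on \<open>'g\<close>, with the convolution
  product of the library. The wrapper type makes concatenation the addition of words.
\<close>

datatype 'g word = Word (letters: "'g list")

instantiation word :: (type) monoid_add
begin

definition "0 = Word []"

definition "u + w = Word (letters u @ letters w)"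

instance
  by standard (simp_all add: zero_word_def plus_word_def)

end

definition gen :: "'g \<Rightarrow> ('g word \<Rightarrow>\<^sub>0 'k::field)" where
  "gen g = Poly_Mapping.single (Word [g]) 1"

text \<open>The free algebra without unit on \<open>X\<close>, spanned by the nonempty words over \<open>X\<close>.\<close>

definition free_alg :: "'g set \<Rightarrow> ('k::field, 'g word \<Rightarrow>\<^sub>0 'k) module" where
  "free_alg X =
     \<lparr>carrier = {a. \<forall>w\<in>Poly_Mapping.keys a. letters w \<noteq> [] \<and> set (letters w) \<subseteq> X},
      mult = (*), one = undefined, zero = 0, add = (+), smult = pm_scale\<rparr>"

text \<open>The algebra homomorphism between free algebras with prescribed values on the generators.\<close>

definition free_lift ::
  "('g \<Rightarrow> ('h word \<Rightarrow>\<^sub>0 'k)) \<Rightarrow> ('g word \<Rightarrow>\<^sub>0 'k::field) \<Rightarrow> ('h word \<Rightarrow>\<^sub>0 'k)" where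
  "free_lift f a = lin_ext (\<lambda>w. prod_list (map f (letters w))) a"

section \<open>Graphs\<close>

text \<open>
  For a directed graph \<open>E\<close>, the source and range maps are \<open>tail E\<close> and \<open>head E\<close>,
  and \<open>s\<^sup>-\<^sup>1(v)\<close> is \<open>out_arcs E v\<close>.
\<close>

definition is_sink :: "('v, 'e) pre_digraph \<Rightarrow> 'v \<Rightarrow> bool" where
  "is_sink E v \<longleftrightarrow> v \<in> verts E \<and> out_arcs E v = {}"

definition regular :: "('v, 'e) pre_digraph \<Rightarrow> 'v \<Rightarrow> bool" where
  "regular E v \<longleftrightarrow> v \<in> verts E \<and> finite (out_arcs E v) \<and> out_arcs E v \<noteq> {}"

definition infinite_emitter :: "('v, 'e) pre_digraph \<Rightarrow> 'v \<Rightarrow> bool" where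
  "infinite_emitter E v \<longleftrightarrow> v \<in> verts E \<and> infinite (out_arcs E v)"

definition connects :: "('v, 'e) pre_digraph \<Rightarrow> 'v \<Rightarrow> 'v \<Rightarrow> bool" where
  "connects E u v \<longleftrightarrow> (\<exists>p. pre_digraph.awalk E u p v)"

definition H_of :: "('v, 'e) pre_digraph \<Rightarrow> 'v \<Rightarrow> 'v set" where
  "H_of E v = verts E - {w \<in> verts E. connects E w v}"

definition hereditary :: "('v, 'e) pre_digraph \<Rightarrow> 'v set \<Rightarrow> bool" where
  "hereditary E H \<longleftrightarrow> H \<subseteq> verts E \<and> (\<forall>u u'. u \<in> H \<longrightarrow> connects E u u' \<longrightarrow> u' \<in> H)"

definition saturated :: "('v, 'e) pre_digraph \<Rightarrow> 'v set \<Rightarrow> bool" where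
  "saturated E H \<longleftrightarrow> (\<forall>u. regular E u \<longrightarrow> head E ` out_arcs E u \<subseteq> H \<longrightarrow> u \<in> H)"

definition out_arcs_off :: "('v, 'e) pre_digraph \<Rightarrow> 'v set \<Rightarrow> 'v \<Rightarrow> 'e set" where
  "out_arcs_off E H u = {e \<in> out_arcs E u. head E e \<notin> H}"

definition breaking :: "('v, 'e) pre_digraph \<Rightarrow> 'v set \<Rightarrow> 'v set" where
  "breaking E H =
     {u \<in> verts E - H. infinite_emitter E u \<and> finite (out_arcs_off E H u) \<and> out_arcs_off E H u \<noteq> {}}"

text \<open>The quotient graph \<open>E \ (H, B\<^sub>H)\<close>.\<close>

definition quot_graph :: "('v, 'e) pre_digraph \<Rightarrow> 'v set \<Rightarrow> ('v, 'e) pre_digraph" where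
  "quot_graph E H = E\<lparr>verts := verts E - H, arcs := {e \<in> arcs E. head E e \<notin> H}\<rparr>"

section \<open>Leavitt path algebras\<close>

datatype ('v, 'e) lgen = Vx 'v | Ed 'e | Gh 'e

type_synonym ('v, 'e, 'k) lfree = "('v, 'e) lgen word \<Rightarrow>\<^sub>0 'k"

definition lgens :: "('v, 'e) pre_digraph \<Rightarrow> ('v, 'e) lgen set" where
  "lgens E = Vx ` verts E \<union> Ed ` arcs E \<union> Gh ` arcs E"

text \<open>The defining relations: each element listed here is to become zero.\<close>

definition lrels :: "('v, 'e) pre_digraph \<Rightarrow> ('v, 'e, 'k::field) lfree set" where
  "lrels E =
     {gen (Vx u) * gen (Vx w) - (if u = w then gen (Vx u) else 0) | u w. u \<in> verts E \<and> w \<in> verts E}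
   \<union> {gen (Vx (tail E e)) * gen (Ed e) - gen (Ed e) | e. e \<in> arcs E}
   \<union> {gen (Ed e) * gen (Vx (head E e)) - gen (Ed e) | e. e \<in> arcs E}
   \<union> {gen (Vx (head E e)) * gen (Gh e) - gen (Gh e) | e. e \<in> arcs E}
   \<union> {gen (Gh e) * gen (Vx (tail E e)) - gen (Gh e) | e. e \<in> arcs E}
   \<union> {gen (Gh e) * gen (Ed f) - (if e = f then gen (Vx (head E e)) else 0) | e f. e \<in> arcs E \<and> f \<in> arcs E}
   \<union> {gen (Vx u) - (\<Sum>e\<in>out_arcs E u. gen (Ed e) * gen (Gh e)) | u. regular E u}"

definition rel_ideal :: "('v, 'e) pre_digraph \<Rightarrow> ('v, 'e, 'k::field) lfree set" where
  "rel_ideal E = alg_ideal_gen (free_alg (lgens E)) (lrels E)"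

definition leavitt :: "('v, 'e) pre_digraph \<Rightarrow> ('k::field, ('v, 'e, 'k) lfree set) module" where
  "leavitt E = alg_quot (free_alg (lgens E)) (rel_ideal E)"

text \<open>The class in \<open>L\<^sub>K(E)\<close> of an element of the free algebra.\<close>

definition lcls :: "('v, 'e) pre_digraph \<Rightarrow> ('v, 'e, 'k::field) lfree \<Rightarrow> ('v, 'e, 'k) lfree set" where
  "lcls E a = rel_ideal E +>\<^bsub>free_alg (lgens E)\<^esub> a"

text \<open>A representative of \<open>u\<^sup>H\<close> in the free algebra.\<close>

definition gap_elem :: "('v, 'e) pre_digraph \<Rightarrow> 'v set \<Rightarrow> 'v \<Rightarrow> ('v, 'e, 'k::field) lfree" where
  "gap_elem E H u = gen (Vx u) - (\<Sum>e\<in>out_arcs_off E H u. gen (Ed e) * gen (Gh e))"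

definition I_ideal :: "('v, 'e) pre_digraph \<Rightarrow> 'v set \<Rightarrow> 'v set \<Rightarrow> ('v, 'e, 'k::field) lfree set set" where
  "I_ideal E H B = alg_ideal_gen (leavitt E)
     ((\<lambda>u. lcls E (gen (Vx u))) ` H \<union> (\<lambda>u. lcls E (gap_elem E H u)) ` B)"

text \<open>
  The quotient map \<open>L\<^sub>K(E) \<rightarrow> L\<^sub>K(E \ (H, B\<^sub>H))\<close>. It is induced by a homomorphism of the
  free algebras; \<open>the_elem\<close> picks the common value on all representatives of a class
  (\<open>quot_map_lcls\<close> below shows that there is one).
\<close>

fun quot_gen :: "('v, 'e) pre_digraph \<Rightarrow> 'v set \<Rightarrow> ('v, 'e) lgen \<Rightarrow> ('v, 'e, 'k::field) lfree" where
  "quot_gen E H (Vx u) = (if u \<in> H then 0 else gen (Vx u))"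
| "quot_gen E H (Ed e) = (if head E e \<in> H then 0 else gen (Ed e))"
| "quot_gen E H (Gh e) = (if head E e \<in> H then 0 else gen (Gh e))"

definition quot_map ::
  "('v, 'e) pre_digraph \<Rightarrow> 'v set \<Rightarrow> ('v, 'e, 'k::field) lfree set \<Rightarrow> ('v, 'e, 'k) lfree set" where
  "quot_map E H X = the_elem ((\<lambda>a. lcls (quot_graph E H) (free_lift (quot_gen E H) a)) ` X)"

section \<open>The modules \<open>N\<^sub>w\<close>\<close>

text \<open>A path is a pair of its source and its list of edges, so that vertices are paths.\<close>

type_synonym ('v, 'e) lpath = "'v \<times> 'e list"

definition paths_to :: "('v, 'e) pre_digraph \<Rightarrow> 'v \<Rightarrow> ('v, 'e) lpath set" where
  "paths_to G w = {(u, p). pre_digraph.awalk G u p w}"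

fun gen_act :: "('v, 'e) pre_digraph \<Rightarrow> ('v, 'e) lgen \<Rightarrow> ('v, 'e) lpath \<Rightarrow> (('v, 'e) lpath \<Rightarrow>\<^sub>0 'k::field)" where
  "gen_act G (Vx u) (x, p) = (if u = x then Poly_Mapping.single (x, p) 1 else 0)"
| "gen_act G (Ed e) (x, p) = (if head G e = x then Poly_Mapping.single (tail G e, e # p) 1 else 0)"
| "gen_act G (Gh e) (x, []) = 0"
| "gen_act G (Gh e) (x, f # p) = (if e = f then Poly_Mapping.single (head G e, p) 1 else 0)"

definition word_act ::
  "('v, 'e) pre_digraph \<Rightarrow> ('v, 'e) lgen word \<Rightarrow> (('v, 'e) lpath \<Rightarrow>\<^sub>0 'k) \<Rightarrow> (('v, 'e) lpath \<Rightarrow>\<^sub>0 'k::field)" where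
  "word_act G w x = foldr (\<lambda>g. lin_ext (gen_act G g)) (letters w) x"

definition free_act ::
  "('v, 'e) pre_digraph \<Rightarrow> ('v, 'e, 'k) lfree \<Rightarrow> (('v, 'e) lpath \<Rightarrow>\<^sub>0 'k) \<Rightarrow> (('v, 'e) lpath \<Rightarrow>\<^sub>0 'k::field)" where
  "free_act G a x = lin_ext (\<lambda>w. word_act G w x) a"

text \<open>For a sink \<open>w\<close>, \<open>the_elem\<close> again picks the common value on all representatives
  (\<open>N_mod_act\<close> below).\<close>

definition N_mod ::
  "('v, 'e) pre_digraph \<Rightarrow> 'v \<Rightarrow> (('v, 'e, 'k::field) lfree set, ('v, 'e) lpath \<Rightarrow>\<^sub>0 'k) module" where
  "N_mod G w =
     \<lparr>carrier = {x. Poly_Mapping.keys x \<subseteq> paths_to G w},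
      mult = undefined, one = undefined, zero = 0, add = (+),
      smult = (\<lambda>X x. the_elem ((\<lambda>a. free_act G a x) ` X))\<rparr>"

definition restrict_scalars :: "('a \<Rightarrow> 'b) \<Rightarrow> ('b, 'n) module \<Rightarrow> ('a, 'n) module" where
  "restrict_scalars h N =
     \<lparr>carrier = carrier N, mult = mult N, one = one N, zero = zero N, add = add N,
      smult = (\<lambda>a x. h a \<odot>\<^bsub>N\<^esub> x)\<rparr>"

text \<open>The \<open>L\<^sub>K(E)\<close>-module \<open>N\<^sub>v\<^sup>H\<^sup>(\<^sup>v\<^sup>)\<close>.\<close>

definition NH_mod ::
  "('v, 'e) pre_digraph \<Rightarrow> 'v \<Rightarrow> (('v, 'e, 'k::field) lfree set, ('v, 'e) lpath \<Rightarrow>\<^sub>0 'k) module" where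
  "NH_mod E v = restrict_scalars (quot_map E (H_of E v)) (N_mod (quot_graph E (H_of E v)) v)"

section \<open>Well-definedness\<close>

text \<open>
  The operations of \<open>leavitt\<close> are those of representatives (\<open>leavitt_ops\<close>), and
  the quotient map and the actions do not depend on the chosen representatives
  (\<open>quot_map_lcls\<close>, \<open>N_mod_act\<close>, \<open>NH_mod_act\<close>).
\<close>

lemma lookup_pm_scale [simp]: "Poly_Mapping.lookup (pm_scale c x) b = c * Poly_Mapping.lookup x b"
  by (simp add: pm_scale_def Poly_Mapping.map.rep_eq when_def)

lemma pm_scale_simps [simp]:
  "pm_scale c 0 = 0" "pm_scale 0 x = 0" "pm_scale 1 x = x"
  "pm_scale c (pm_scale d x) = pm_scale (c * d) x"
  "pm_scale c (x + y) = pm_scale c x + pm_scale c y"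
  "pm_scale c (x - y) = pm_scale c x - pm_scale c y"
  "pm_scale c (Poly_Mapping.single b d) = Poly_Mapping.single b (c * d)"
  by (auto intro!: poly_mapping_eqI simp: lookup_add lookup_minus lookup_single algebra_simps when_def)

lemma pm_scale_add_left: "pm_scale (c + d) x = pm_scale c x + pm_scale d x"
  by (rule poly_mapping_eqI) (simp add: lookup_add algebra_simps)

lemma pm_scale_minus1: "pm_scale (-1) x = - x"
  by (rule poly_mapping_eqI) simp

lemma pm_scale_sum: "pm_scale c (\<Sum>i\<in>S. f i) = (\<Sum>i\<in>S. pm_scale c (f i))"
  by (induction S rule: infinite_finite_induct) auto

lemma keys_pm_scale: "Poly_Mapping.keys (pm_scale c x) \<subseteq> Poly_Mapping.keys x"
  by (auto simp: in_keys_iff)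

lemma pm_expand: "x = (\<Sum>b\<in>Poly_Mapping.keys x. Poly_Mapping.single b (Poly_Mapping.lookup x b))"
proof (rule poly_mapping_eqI)
  fix k
  show "Poly_Mapping.lookup x k =
    Poly_Mapping.lookup (\<Sum>b\<in>Poly_Mapping.keys x. Poly_Mapping.single b (Poly_Mapping.lookup x b)) k"
    by (cases "k \<in> Poly_Mapping.keys x")
       (auto simp: lookup_sum lookup_single when_def in_keys_iff sum.delta)
qed

lemma lin_ext_superset:
  assumes "finite S" "Poly_Mapping.keys x \<subseteq> S"
  shows "lin_ext f x = (\<Sum>b\<in>S. pm_scale (Poly_Mapping.lookup x b) (f b))"
  unfolding lin_ext_def using assms
  by (intro sum.mono_neutral_left) (auto simp: in_keys_iff)

lemma lin_ext_add: "lin_ext f (x + y) = lin_ext f x + lin_ext f y"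
proof -
  let ?S = "Poly_Mapping.keys x \<union> Poly_Mapping.keys y"
  have "finite ?S" "Poly_Mapping.keys (x + y) \<subseteq> ?S" using keys_add[of x y] by auto
  then show ?thesis
    by (simp add: lin_ext_superset[where S = ?S] lookup_add pm_scale_add_left sum.distrib)
qed

lemma lin_ext_scale: "lin_ext f (pm_scale c x) = pm_scale c (lin_ext f x)"
  using lin_ext_superset[of "Poly_Mapping.keys x" "pm_scale c x" f] keys_pm_scale[of c x]
  by (simp add: lin_ext_def pm_scale_sum)

lemma lin_ext_0 [simp]: "lin_ext f 0 = 0"
  by (simp add: lin_ext_def)

lemma lin_ext_single [simp]: "lin_ext f (Poly_Mapping.single b c) = pm_scale c (f b)"
  by (cases "c = 0") (simp_all add: lin_ext_def)

lemma lin_ext_minus: "lin_ext f (x - y) = lin_ext f x - lin_ext f y"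
proof -
  have "x - y = x + pm_scale (-1) y" by (simp add: pm_scale_minus1)
  then show ?thesis by (simp only: lin_ext_add lin_ext_scale) (simp add: pm_scale_minus1)
qed

lemma lin_ext_sum: "lin_ext f (\<Sum>i\<in>S. x i) = (\<Sum>i\<in>S. lin_ext f (x i))"
  by (induction S rule: infinite_finite_induct) (auto simp: lin_ext_add)

lemma keys_lin_ext:
  assumes "\<And>b. b \<in> Poly_Mapping.keys x \<Longrightarrow> Poly_Mapping.keys (f b) \<subseteq> T"
  shows "Poly_Mapping.keys (lin_ext f x) \<subseteq> T"
proof -
  have "Poly_Mapping.keys (lin_ext f x) \<subseteq>
      (\<Union>b\<in>Poly_Mapping.keys x. Poly_Mapping.keys (pm_scale (Poly_Mapping.lookup x b) (f b)))"
    unfolding lin_ext_def by (rule keys_sum)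
  also have "\<dots> \<subseteq> T"
    by (rule UN_least) (rule subset_trans[OF keys_pm_scale assms])
  finally show ?thesis .
qed

lemma lin_ext_unique:
  assumes "\<And>x y. F (x + y) = F x + F y" "F 0 = 0"
    and "\<And>b c. F (Poly_Mapping.single b c) = pm_scale c (f b)"
  shows "F x = lin_ext f x"
proof -
  have s: "F (\<Sum>i\<in>S. y i) = (\<Sum>i\<in>S. F (y i))" for S y
    by (induction S rule: infinite_finite_induct) (auto simp: assms)
  have "F x = F (\<Sum>b\<in>Poly_Mapping.keys x. Poly_Mapping.single b (Poly_Mapping.lookup x b))"
    by (rule arg_cong[OF pm_expand])
  then show ?thesis unfolding s assms(3) lin_ext_def .
qed

lemma word_act_add: "word_act G w (x + y) = word_act G w x + word_act G w y"
proof -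
  have "foldr (\<lambda>g. lin_ext (gen_act G g)) l (x + y) =
    foldr (\<lambda>g. lin_ext (gen_act G g)) l x + foldr (\<lambda>g. lin_ext (gen_act G g)) l y" for l
    by (induction l) (auto simp: lin_ext_add)
  then show ?thesis by (simp add: word_act_def)
qed

lemma word_act_scale: "word_act G w (pm_scale c x) = pm_scale c (word_act G w x)"
proof -
  have "foldr (\<lambda>g. lin_ext (gen_act G g)) l (pm_scale c x) =
    pm_scale c (foldr (\<lambda>g. lin_ext (gen_act G g)) l x)" for l
    by (induction l) (auto simp: lin_ext_scale)
  then show ?thesis by (simp add: word_act_def)
qed

lemma word_act_0 [simp]: "word_act G w 0 = 0"
  using word_act_scale[of G w 0 0] by simp

lemma word_act_plus: "word_act G (u + w) x = word_act G u (word_act G w x)"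
  by (simp add: word_act_def plus_word_def)

lemma free_act_add: "free_act G (a + b) x = free_act G a x + free_act G b x"
  and free_act_minus: "free_act G (a - b) x = free_act G a x - free_act G b x"
  and free_act_scale: "free_act G (pm_scale c a) x = pm_scale c (free_act G a x)"
  and free_act_0 [simp]: "free_act G 0 x = 0"
  by (simp_all add: free_act_def lin_ext_add lin_ext_minus lin_ext_scale)

lemma free_act_sum: "free_act G (\<Sum>i\<in>S. a i) x = (\<Sum>i\<in>S. free_act G (a i) x)"
  by (simp add: free_act_def lin_ext_sum)

lemma free_act_add_right: "free_act G a (x + y) = free_act G a x + free_act G a y"
  by (simp add: free_act_def lin_ext_def word_act_add sum.distrib)

lemma free_act_scale_right: "free_act G a (pm_scale c x) = pm_scale c (free_act G a x)"
  by (simp add: free_act_def lin_ext_def word_act_scale pm_scale_sum mult.commute)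

lemma free_act_0_right [simp]: "free_act G a 0 = 0"
  by (simp add: free_act_def lin_ext_def)

lemma free_act_sum_right: "free_act G a (\<Sum>i\<in>S. x i) = (\<Sum>i\<in>S. free_act G a (x i))"
  by (induction S rule: infinite_finite_induct) (auto simp: free_act_add_right)

lemma free_act_mult: "free_act G (a * b) x = free_act G a (free_act G b x)"
proof -
  have 1: "free_act G (Poly_Mapping.single u c * b) x = pm_scale c (word_act G u (free_act G b x))" for u c
  proof -
    have "free_act G (Poly_Mapping.single u c * b) x
       = lin_ext (\<lambda>w. pm_scale c (word_act G u (word_act G w x))) b"
      by (rule lin_ext_unique)
         (simp_all add: distrib_left mult_single free_act_def lin_ext_add word_act_plus mult.commute)
    also have "\<dots> = pm_scale c (word_act G u (free_act G b x))"
      by (rule lin_ext_unique[symmetric])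
         (simp_all add: free_act_add word_act_add, simp add: free_act_def word_act_scale mult.commute)
    finally show ?thesis .
  qed
  have "free_act G (a * b) x = lin_ext (\<lambda>u. word_act G u (free_act G b x)) a"
    by (rule lin_ext_unique[where F = "\<lambda>a. free_act G (a * b) x"])
       (simp_all add: distrib_right free_act_add 1)
  then show ?thesis by (simp add: free_act_def)
qed

lemma free_act_gen [simp]: "free_act G (gen g) x = lin_ext (gen_act G g) x"
  by (simp add: free_act_def gen_def word_act_def)

lemma free_lift_add: "free_lift f (a + b) = free_lift f a + free_lift f b"
  and free_lift_minus: "free_lift f (a - b) = free_lift f a - free_lift f b"
  and free_lift_scale: "free_lift f (pm_scale c a) = pm_scale c (free_lift f a)"
  and free_lift_0 [simp]: "free_lift f 0 = 0"
  and free_lift_sum: "free_lift f (\<Sum>i\<in>S. h i) = (\<Sum>i\<in>S. free_lift f (h i))"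
  by (simp_all add: free_lift_def lin_ext_add lin_ext_minus lin_ext_scale lin_ext_sum)

lemma free_lift_gen [simp]: "free_lift f (gen g) = f g"
  by (simp add: free_lift_def gen_def)

lemma pm_scale_mult:
  fixes a b :: "'g word \<Rightarrow>\<^sub>0 'k::field"
  shows "pm_scale c (a * b) = pm_scale c a * b" "pm_scale c (a * b) = a * pm_scale c b"
proof -
  have S: "pm_scale c x = lin_ext (\<lambda>b. Poly_Mapping.single b c) x" for x :: "'g word \<Rightarrow>\<^sub>0 'k"
    by (rule lin_ext_unique) (simp_all add: mult.commute)
  have L: "pm_scale c x = Poly_Mapping.single 0 c * x" for x :: "'g word \<Rightarrow>\<^sub>0 'k"
    unfolding S by (rule lin_ext_unique[symmetric]) (simp_all add: distrib_left mult_single mult.commute)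
  have R: "pm_scale c x = x * Poly_Mapping.single 0 c" for x :: "'g word \<Rightarrow>\<^sub>0 'k"
    unfolding S by (rule lin_ext_unique[symmetric]) (simp_all add: distrib_right mult_single)
  show "pm_scale c (a * b) = pm_scale c a * b" by (simp add: L mult.assoc)
  show "pm_scale c (a * b) = a * pm_scale c b" by (simp add: R mult.assoc)
qed

lemma free_lift_mult: "free_lift f (a * b) = free_lift f a * free_lift f b"
proof -
  let ?p = "\<lambda>w. prod_list (map f (letters w))"
  have 1: "free_lift f (Poly_Mapping.single u c * b) = pm_scale c (?p u * free_lift f b)" for u c
  proof -
    have "free_lift f (Poly_Mapping.single u c * b)
       = lin_ext (\<lambda>w. pm_scale c (?p u * ?p w)) b"
      by (rule lin_ext_unique)
         (simp_all add: distrib_left mult_single free_lift_def lin_ext_add plus_word_def mult.commute)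
    also have "\<dots> = pm_scale c (?p u * free_lift f b)"
    proof (rule lin_ext_unique[symmetric])
      show "pm_scale c (?p u * free_lift f (Poly_Mapping.single w d)) = pm_scale d (pm_scale c (?p u * ?p w))" for w d
        unfolding free_lift_def lin_ext_single pm_scale_mult(2)[symmetric] by (simp add: mult.commute)
    qed (simp_all add: free_lift_add distrib_left)
    finally show ?thesis .
  qed
  have A: "free_lift f (a * b) = lin_ext (\<lambda>u. ?p u * free_lift f b) a"
    by (rule lin_ext_unique[where F = "\<lambda>a. free_lift f (a * b)"])
       (simp_all add: distrib_right free_lift_add 1)
  have B: "free_lift f a * free_lift f b = lin_ext (\<lambda>u. ?p u * free_lift f b) a"
    by (rule lin_ext_unique[where F = "\<lambda>a. free_lift f a * free_lift f b"])
       (simp_all add: distrib_right free_lift_add, unfold free_lift_def lin_ext_single, rule pm_scale_mult(1)[symmetric])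
  show ?thesis by (rule trans[OF A B[symmetric]])
qed

subsection \<open>Ideals and classes\<close>

lemma free_alg_simps [simp]:
  "mult (free_alg X) = (*)" "zero (free_alg X) = 0" "add (free_alg X) = (+)" "smult (free_alg X) = pm_scale"
  by (simp_all add: free_alg_def)

lemma free_alg_carrier: "a \<in> carrier (free_alg X) \<longleftrightarrow>
   (\<forall>w\<in>Poly_Mapping.keys a. letters w \<noteq> [] \<and> set (letters w) \<subseteq> X)"
  by (simp add: free_alg_def)

lemma free_alg_closed:
  "0 \<in> carrier (free_alg X)"
  "a \<in> carrier (free_alg X) \<Longrightarrow> b \<in> carrier (free_alg X) \<Longrightarrow> a + b \<in> carrier (free_alg X)"
  "a \<in> carrier (free_alg X) \<Longrightarrow> b \<in> carrier (free_alg X) \<Longrightarrow> a - b \<in> carrier (free_alg X)"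
  "a \<in> carrier (free_alg X) \<Longrightarrow> b \<in> carrier (free_alg X) \<Longrightarrow> a * b \<in> carrier (free_alg X)"
  "a \<in> carrier (free_alg X) \<Longrightarrow> pm_scale c a \<in> carrier (free_alg X)"
  using keys_add[of a b] keys_diff[of a b] keys_mult[of a b] keys_pm_scale[of c a]
  unfolding free_alg_carrier by (simp, blast, blast, fastforce simp: plus_word_def, blast)

lemma free_alg_sum: "(\<And>i. i \<in> S \<Longrightarrow> f i \<in> carrier (free_alg X)) \<Longrightarrow> (\<Sum>i\<in>S. f i) \<in> carrier (free_alg X)"
  by (induction S rule: infinite_finite_induct)
     (auto intro: free_alg_closed)

lemma gen_carrier: "gen g \<in> carrier (free_alg X) \<longleftrightarrow> g \<in> X"
  by (simp add: free_alg_carrier gen_def)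

lemma lgens_simps [simp]:
  "Vx u \<in> lgens E \<longleftrightarrow> u \<in> verts E" "Ed e \<in> lgens E \<longleftrightarrow> e \<in> arcs E" "Gh e \<in> lgens E \<longleftrightarrow> e \<in> arcs E"
  by (auto simp: lgens_def)

lemma lrels_carrier:
  assumes "wf_digraph E" shows "lrels E \<subseteq> carrier (free_alg (lgens E))"
proof -
  interpret wf_digraph E by fact
  show ?thesis
    by (auto simp: lrels_def gen_carrier regular_def intro!: free_alg_closed free_alg_sum)
qed

lemma alg_ideal_carrier: "alg_ideal (free_alg X) (carrier (free_alg X))"
  by (auto simp: alg_ideal_def intro: free_alg_closed simp: free_alg_carrier[of 0])

lemma alg_ideal_gen_ideal:
  assumes "S \<subseteq> carrier (free_alg X)"
  shows "alg_ideal (free_alg X) (alg_ideal_gen (free_alg X) S)"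
proof -
  let ?F = "{I. alg_ideal (free_alg X) I \<and> S \<subseteq> I}"
  have "carrier (free_alg X) \<in> ?F" using assms alg_ideal_carrier by auto
  then show ?thesis unfolding alg_ideal_gen_def
    by (subst alg_ideal_def) (auto, (auto simp: alg_ideal_def)[])
qed

lemma alg_ideal_gen_least: "alg_ideal A I \<Longrightarrow> S \<subseteq> I \<Longrightarrow> alg_ideal_gen A S \<subseteq> I"
  by (auto simp: alg_ideal_gen_def)

lemma alg_ideal_gen_super: "S \<subseteq> alg_ideal_gen A S"
  by (auto simp: alg_ideal_gen_def)

lemma lrels_rel_ideal: "r \<in> lrels E \<Longrightarrow> r \<in> rel_ideal E"
  unfolding rel_ideal_def by (rule subsetD[OF alg_ideal_gen_super])

lemma rel_ideal_rels:
  "u \<in> verts E \<Longrightarrow> w \<in> verts E \<Longrightarrow> gen (Vx u) * gen (Vx w) - (if u = w then gen (Vx u) else 0) \<in> rel_ideal E"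
  "e \<in> arcs E \<Longrightarrow> gen (Vx (tail E e)) * gen (Ed e) - gen (Ed e) \<in> rel_ideal E"
  "e \<in> arcs E \<Longrightarrow> gen (Ed e) * gen (Vx (head E e)) - gen (Ed e) \<in> rel_ideal E"
  "e \<in> arcs E \<Longrightarrow> gen (Vx (head E e)) * gen (Gh e) - gen (Gh e) \<in> rel_ideal E"
  "e \<in> arcs E \<Longrightarrow> gen (Gh e) * gen (Vx (tail E e)) - gen (Gh e) \<in> rel_ideal E"
  "e \<in> arcs E \<Longrightarrow> f \<in> arcs E \<Longrightarrow> gen (Gh e) * gen (Ed f) - (if e = f then gen (Vx (head E e)) else 0) \<in> rel_ideal E"
  "regular E u \<Longrightarrow> gen (Vx u) - (\<Sum>e\<in>out_arcs E u. gen (Ed e) * gen (Gh e)) \<in> rel_ideal E"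
  by (rule lrels_rel_ideal, unfold lrels_def, blast)+

lemma quot_graph_simps [simp]:
  "verts (quot_graph E H) = verts E - H" "arcs (quot_graph E H) = {e \<in> arcs E. head E e \<notin> H}"
  "tail (quot_graph E H) = tail E" "head (quot_graph E H) = head E"
  by (simp_all add: quot_graph_def)

lemma rel_ideal: "wf_digraph E \<Longrightarrow> alg_ideal (free_alg (lgens E)) (rel_ideal E)"
  unfolding rel_ideal_def by (intro alg_ideal_gen_ideal lrels_carrier)

lemma rel_idealD:
  assumes "wf_digraph E"
  shows "0 \<in> rel_ideal E" "x \<in> rel_ideal E \<Longrightarrow> y \<in> rel_ideal E \<Longrightarrow> x + y \<in> rel_ideal E"
    "x \<in> rel_ideal E \<Longrightarrow> y \<in> rel_ideal E \<Longrightarrow> x - y \<in> rel_ideal E"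
    "x \<in> rel_ideal E \<Longrightarrow> pm_scale c x \<in> rel_ideal E"
    "x \<in> rel_ideal E \<Longrightarrow> a \<in> carrier (free_alg (lgens E)) \<Longrightarrow> a * x \<in> rel_ideal E"
    "x \<in> rel_ideal E \<Longrightarrow> a \<in> carrier (free_alg (lgens E)) \<Longrightarrow> x * a \<in> rel_ideal E"
    "x \<in> rel_ideal E \<Longrightarrow> x \<in> carrier (free_alg (lgens E))"
proof -
  note I = rel_ideal[OF assms, unfolded alg_ideal_def, simplified]
  show s: "x \<in> rel_ideal E \<Longrightarrow> pm_scale c x \<in> rel_ideal E" for x c using I by auto
  show p: "x \<in> rel_ideal E \<Longrightarrow> y \<in> rel_ideal E \<Longrightarrow> x + y \<in> rel_ideal E" for x y using I by auto
  show "x \<in> rel_ideal E \<Longrightarrow> y \<in> rel_ideal E \<Longrightarrow> x - y \<in> rel_ideal E"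
    using p[of x "pm_scale (-1) y"] s[of y "-1"] by (simp add: pm_scale_minus1)
qed (use rel_ideal[OF assms, unfolded alg_ideal_def, simplified] in auto)

lemma lcls_eq: "lcls E a = {h + a | h. h \<in> rel_ideal E}"
  by (auto simp: lcls_def a_r_coset_def')

lemma lcls_eq_iff:
  assumes "wf_digraph E"
  shows "lcls E a = lcls E b \<longleftrightarrow> a - b \<in> rel_ideal E"
proof
  assume "lcls E a = lcls E b"
  moreover have "a \<in> lcls E a" using rel_idealD(1)[OF assms] unfolding lcls_eq by force
  ultimately obtain h where "a = h + b" "h \<in> rel_ideal E" unfolding lcls_eq by blast
  then show "a - b \<in> rel_ideal E" by simp
next
  assume d: "a - b \<in> rel_ideal E"
  have "h + a = (h + (a - b)) + b" "h + b = (h - (a - b)) + a" for h by auto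
  then show "lcls E a = lcls E b"
    using rel_idealD[OF assms] d unfolding lcls_eq by blast
qed

lemma lcls_mem:
  assumes "wf_digraph E" shows "x \<in> lcls E a \<longleftrightarrow> x - a \<in> rel_ideal E"
  unfolding lcls_eq by (auto intro: exI[of _ "x - a"])

lemma leavitt_carrier: "carrier (leavitt E) = lcls E ` carrier (free_alg (lgens E))"
  by (auto simp: leavitt_def alg_quot_def lcls_def A_RCOSETS_def')

lemma leavitt_ops:
  assumes E: "wf_digraph E"
    and a: "a \<in> carrier (free_alg (lgens E))" and b: "b \<in> carrier (free_alg (lgens E))"
  shows "lcls E a \<oplus>\<^bsub>leavitt E\<^esub> lcls E b = lcls E (a + b)"
    and "lcls E a \<otimes>\<^bsub>leavitt E\<^esub> lcls E b = lcls E (a * b)"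
    and "c \<odot>\<^bsub>leavitt E\<^esub> lcls E a = lcls E (pm_scale c a)"
    and "\<zero>\<^bsub>leavitt E\<^esub> = lcls E 0"
proof -
  note I = rel_idealD[OF E]
  have self: "x \<in> lcls E x" for x using I(1) by (simp add: lcls_mem[OF E])
  have c: "x \<in> carrier (free_alg (lgens E))" if "x \<in> lcls E y" "y \<in> carrier (free_alg (lgens E))" for x y
    using that I(7)[of "x - y"] free_alg_closed(2)[of "x - y" _ y] by (simp add: lcls_mem[OF E])
  show "\<zero>\<^bsub>leavitt E\<^esub> = lcls E 0" by (simp add: leavitt_def alg_quot_def lcls_eq)
  show "lcls E a \<oplus>\<^bsub>leavitt E\<^esub> lcls E b = lcls E (a + b)"
  proof -
    have "x + y \<in> lcls E (a + b)" if "x \<in> lcls E a" "y \<in> lcls E b" for x y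
      using that I(2)[of "x - a" "y - b"] by (simp add: lcls_mem[OF E] algebra_simps)
    moreover have "\<exists>x\<in>lcls E a. \<exists>y\<in>lcls E b. z = x + y" if "z \<in> lcls E (a + b)" for z
      using that self[of b] by (intro bexI[of _ "z - b"] bexI[of _ b]) (auto simp: lcls_mem[OF E] algebra_simps)
    ultimately show ?thesis by (auto simp: leavitt_def alg_quot_def set_add_def')
  qed
  show "lcls E a \<otimes>\<^bsub>leavitt E\<^esub> lcls E b = lcls E (a * b)"
  proof -
    have "lcls E (x * y) = lcls E (a * b)" if "x \<in> lcls E a" "y \<in> lcls E b" for x y
    proof -
      have "x * y - a * b = (x - a) * y + a * (y - b)" by (simp add: algebra_simps)
      also have "\<dots> \<in> rel_ideal E"
        using that c[OF that(2) b] a by (intro I(2) I(5) I(6)) (auto simp: lcls_mem[OF E])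
      finally show ?thesis by (simp add: lcls_eq_iff[OF E])
    qed
    then have "(\<Union>x\<in>lcls E a. \<Union>y\<in>lcls E b. lcls E (x * y)) = (\<Union>x\<in>lcls E a. \<Union>y\<in>lcls E b. lcls E (a * b))"
      by (intro SUP_cong refl)
    also have "\<dots> = lcls E (a * b)" using self[of a] self[of b] by blast
    finally show ?thesis by (simp add: leavitt_def alg_quot_def rcoset_mult_def flip: lcls_def)
  qed
  show "c \<odot>\<^bsub>leavitt E\<^esub> lcls E a = lcls E (pm_scale c a)"
  proof -
    have "lcls E (pm_scale c x) = lcls E (pm_scale c a)" if "x \<in> lcls E a" for x
      using that I(4)[of "x - a" c] by (simp add: lcls_eq_iff[OF E] lcls_mem[OF E])
    then have "(\<Union>x\<in>lcls E a. lcls E (pm_scale c x)) = (\<Union>x\<in>lcls E a. lcls E (pm_scale c a))"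
      by (intro SUP_cong refl)
    also have "\<dots> = lcls E (pm_scale c a)" using self[of a] by blast
    finally show ?thesis by (simp add: leavitt_def alg_quot_def flip: lcls_def)
  qed
qed

lemma lcls_the_elem:
  assumes E: "wf_digraph E" and "\<And>h. h \<in> rel_ideal E \<Longrightarrow> F (h + a) = F a"
  shows "the_elem (F ` lcls E a) = F a"
proof -
  have "a \<in> lcls E a" using rel_idealD(1)[OF E] by (simp add: lcls_mem[OF E])
  then have "F ` lcls E a = {F a}" using assms(2) unfolding lcls_eq by auto
  then show ?thesis by simp
qed

subsection \<open>The quotient map\<close>

lemma connects_arc:
  assumes "wf_digraph E" "e \<in> arcs E" "connects E (head E e) v"
  shows "connects E (tail E e) v"
proof -
  interpret wf_digraph E by fact
  show ?thesis using assms(2,3) unfolding connects_def awalk_def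
    by (metis cas.simps(2) insert_subset list.simps(15) tail_in_verts)
qed

lemma quot_graph_wf:
  assumes "wf_digraph E" "hereditary E H"
  shows "wf_digraph (quot_graph E H)"
proof -
  interpret wf_digraph E by fact
  have "connects E (tail E e) (head E e)" if "e \<in> arcs E" for e
    by (rule connects_arc[OF assms(1) that]) (use that in \<open>auto simp: connects_def awalk_def intro!: exI[of _ "[]"]\<close>)
  then have "tail E e \<notin> H" if "e \<in> arcs E" "head E e \<notin> H" for e
    using assms(2) that unfolding hereditary_def by blast
  then show ?thesis by unfold_locales (auto simp: quot_graph_def)
qed

lemma quot_rel:
  fixes E :: "('v, 'e) pre_digraph" and h :: "('v, 'e, 'k::field) lfree"
  assumes E: "wf_digraph E" and H: "hereditary E H" "saturated E H" and h: "h \<in> rel_ideal E"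
  shows "free_lift (quot_gen E H) h \<in> rel_ideal (quot_graph E H)"
proof -
  let ?G = "quot_graph E H" and ?f = "free_lift (quot_gen E H) :: ('v, 'e, 'k) lfree \<Rightarrow> _"
  interpret wf_digraph E by fact
  have G: "wf_digraph ?G" by (rule quot_graph_wf[OF E H(1)])
  note I = rel_idealD[OF G]
  note R = rel_ideal_rels[where E = ?G, simplified quot_graph_simps]
  have tl: "head E e \<in> H" if "e \<in> arcs E" "tail E e \<in> H" for e
    using quot_graph_wf[OF E H(1)] that unfolding wf_digraph_def quot_graph_def by auto
  have gc: "quot_gen E H g \<in> carrier (free_alg (lgens ?G))" if "g \<in> lgens E" for g
    using that by (cases g) (auto simp: gen_carrier quot_graph_def free_alg_carrier[of 0])
  have fc: "?f a \<in> carrier (free_alg (lgens ?G))" if "a \<in> carrier (free_alg (lgens E))" for a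
  proof -
    have pl: "prod_list (map (quot_gen E H) l) \<in> carrier (free_alg (lgens ?G))"
      if "l \<noteq> []" "set l \<subseteq> lgens E" for l
      using that by (induction l rule: list_nonempty_induct) (auto intro: gc free_alg_closed)
    show ?thesis unfolding free_lift_def lin_ext_def
      by (rule free_alg_sum) (use that in \<open>auto simp: free_alg_carrier[of a] intro!: free_alg_closed(5) pl\<close>)
  qed
  let ?J = "{a \<in> carrier (free_alg (lgens E)). ?f a \<in> rel_ideal ?G}"
  have J: "alg_ideal (free_alg (lgens E)) ?J"
    unfolding alg_ideal_def
    by (auto simp: free_lift_add free_lift_mult free_lift_scale free_alg_closed intro!: I(1,2,4) intro: I(5,6) fc)
  have "?f r \<in> rel_ideal ?G" if "r \<in> lrels E" for r
  proof -
    have V: "quot_gen E H (Vx u) * quot_gen E H (Vx w) - (if u = w then quot_gen E H (Vx u) else 0) \<in> (rel_ideal ?G :: ('v, 'e, 'k) lfree set)"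
      if "u \<in> verts E" "w \<in> verts E" for u w
      using that I(1) R(1)[of u w] by auto
    have ck2: "quot_gen E H (Vx u) - (\<Sum>e\<in>out_arcs E u. quot_gen E H (Ed e) * quot_gen E H (Gh e)) \<in> (rel_ideal ?G :: ('v, 'e, 'k) lfree set)"
      if u: "regular E u" for u
    proof (cases "u \<in> H")
      case True
      then have "(\<Sum>e\<in>out_arcs E u. quot_gen E H (Ed e) * quot_gen E H (Gh e)) = (0 :: ('v, 'e, 'k) lfree)"
        using tl by (intro sum.neutral) auto
      then show ?thesis using True I(1) by simp
    next
      case False
      have o: "out_arcs ?G u = {e \<in> out_arcs E u. head E e \<notin> H}"
        by (auto simp: out_arcs_def quot_graph_def)
      have r: "regular ?G u"
        using u False H(2) finite_subset[of "{e \<in> out_arcs E u. head E e \<notin> H}" "out_arcs E u"]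
        unfolding saturated_def regular_def o by (auto simp del: in_out_arcs_conv)
      have "(\<Sum>e\<in>out_arcs E u. quot_gen E H (Ed e) * quot_gen E H (Gh e))
          = (\<Sum>e\<in>out_arcs ?G u. gen (Ed e) * gen (Gh e) :: ('v, 'e, 'k) lfree)"
        using u unfolding o by (intro sum.mono_neutral_cong_right) (auto simp: regular_def)
      then show ?thesis using R(7)[OF r] False by simp
    qed
    show ?thesis
      using that unfolding lrels_def
    proof (elim UnE CollectE exE conjE, goal_cases)
      case (1 u w) then show ?case using V[of u w]
        by (cases "u = w") (simp_all add: free_lift_minus free_lift_mult del: quot_gen.simps)
    next
      case (2 e) then show ?case using I(1) tl[of e] R(2)[of e]
        by (auto simp: free_lift_minus free_lift_mult)
    next
      case (3 e) then show ?case using I(1) tl[of e] R(3)[of e]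
        by (auto simp: free_lift_minus free_lift_mult)
    next
      case (4 e) then show ?case using I(1) tl[of e] R(4)[of e]
        by (auto simp: free_lift_minus free_lift_mult)
    next
      case (5 e) then show ?case using I(1) tl[of e] R(5)[of e]
        by (auto simp: free_lift_minus free_lift_mult)
    next
      case (6 e f) then show ?case using I(1) tl[of e] R(6)[of e f]
        by (auto simp: free_lift_minus free_lift_mult)
    next
      case (7 u) then show ?case using ck2[of u]
        by (simp add: free_lift_minus free_lift_mult free_lift_sum)
    qed
  qed
  then have "lrels E \<subseteq> ?J" using lrels_carrier[OF E] by auto
  then show ?thesis using alg_ideal_gen_least[OF J] h unfolding rel_ideal_def by blast
qed

lemma quot_map_lcls:
  assumes E: "wf_digraph E" and H: "hereditary E H" "saturated E H"
  shows "quot_map E H (lcls E a) = lcls (quot_graph E H) (free_lift (quot_gen E H) a)"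
  unfolding quot_map_def
  by (rule lcls_the_elem[OF E])
     (simp add: free_lift_add lcls_eq_iff[OF quot_graph_wf[OF E H(1)]] quot_rel[OF E H])

subsection \<open>The module action\<close>

lemma paths_to_Cons:
  assumes "wf_digraph G"
  shows "(x, e # p) \<in> paths_to G w \<longleftrightarrow> e \<in> arcs G \<and> x = tail G e \<and> (head G e, p) \<in> paths_to G w"
proof -
  interpret wf_digraph G by fact
  show ?thesis by (auto simp: paths_to_def awalk_def)
qed

lemma paths_to_Nil: "(x, []) \<in> paths_to G w \<longleftrightarrow> x = w \<and> w \<in> verts G"
  unfolding paths_to_def pre_digraph.awalk_def by (auto simp: pre_digraph.cas.simps(1))

lemma paths_to_vert: "(x, p) \<in> paths_to G w \<Longrightarrow> x \<in> verts G"
  by (auto simp: paths_to_def pre_digraph.awalk_def)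

lemma gen_act_closed:
  assumes "wf_digraph G" "g \<in> lgens G" "q \<in> paths_to G w"
  shows "Poly_Mapping.keys (gen_act G g q) \<subseteq> paths_to G w"
  using assms(2,3)
  by (cases "(G, g, q)" rule: gen_act.cases) (auto simp: paths_to_Cons[OF assms(1)])

lemma free_act_closed:
  assumes G: "wf_digraph G" and a: "a \<in> carrier (free_alg (lgens G))"
    and x: "Poly_Mapping.keys x \<subseteq> paths_to G w"
  shows "Poly_Mapping.keys (free_act G a x) \<subseteq> paths_to G w"
proof -
  have k: "Poly_Mapping.keys (foldr (\<lambda>g. lin_ext (gen_act G g)) l x) \<subseteq> paths_to G w" if "set l \<subseteq> lgens G" for l
    using that
  proof (induction l)
    case Nil
    show ?case using x by simp
  next
    case (Cons g l)
    have k: "Poly_Mapping.keys (foldr (\<lambda>g. lin_ext (gen_act G g)) l x) \<subseteq> paths_to G w"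
      using Cons by simp
    have g: "g \<in> lgens G" using Cons.prems by simp
    show ?case unfolding foldr.simps o_apply
      by (rule keys_lin_ext, rule gen_act_closed[OF G g], rule subsetD[OF k])
  qed
  have l: "set (letters b) \<subseteq> lgens G" if "b \<in> Poly_Mapping.keys a" for b
    using a that by (simp add: free_alg_carrier)
  show ?thesis unfolding free_act_def word_act_def by (rule keys_lin_ext, rule k, rule l)
qed

lemma rel_act:
  fixes G :: "('v, 'e) pre_digraph" and h :: "('v, 'e, 'k::field) lfree"
  assumes G: "wf_digraph G" and w: "is_sink G w" and h: "h \<in> rel_ideal G"
    and x: "Poly_Mapping.keys x \<subseteq> paths_to G w"
  shows "free_act G h x = 0"
proof -
  interpret wf_digraph G by fact
  let ?N = "{x :: ('v, 'e) lpath \<Rightarrow>\<^sub>0 'k. Poly_Mapping.keys x \<subseteq> paths_to G w}"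
  let ?J = "{a \<in> carrier (free_alg (lgens G)). \<forall>x\<in>?N. free_act G a x = 0}"
  have J: "alg_ideal (free_alg (lgens G)) ?J"
  proof -
    have z: "free_act G (a * y) x = 0" "free_act G (y * a) x = 0"
      if a: "a \<in> carrier (free_alg (lgens G))" and y: "y \<in> ?J" and x: "x \<in> ?N" for a y x
    proof -
      have "free_act G a x \<in> ?N" using free_act_closed[OF G a, of x w] x by blast
      then have "free_act G y (free_act G a x) = 0" "free_act G y x = 0" using y x by blast+
      then show "free_act G (a * y) x = 0" "free_act G (y * a) x = 0" by (simp_all add: free_act_mult)
    qed
    have j: "?J \<subseteq> carrier (free_alg (lgens G))" "0 \<in> ?J" by (auto simp: free_alg_closed)
    have k: "\<forall>x\<in>?J. \<forall>y\<in>?J. x + y \<in> ?J" "\<forall>c. \<forall>x\<in>?J. pm_scale c x \<in> ?J"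
      by (simp_all add: free_act_add free_act_scale free_alg_closed)
    have "a * y \<in> ?J \<and> y * a \<in> ?J" if "a \<in> carrier (free_alg (lgens G))" "y \<in> ?J" for a y
      using that z[OF that] free_alg_closed(4) by blast
    then have "\<forall>a\<in>carrier (free_alg (lgens G)). \<forall>y\<in>?J. a * y \<in> ?J \<and> y * a \<in> ?J"
      by (intro ballI)
    then show ?thesis unfolding alg_ideal_def free_alg_simps by (intro conjI j k)
  qed
  have "free_act G r x = 0" if r: "r \<in> lrels G" and x: "Poly_Mapping.keys x \<subseteq> paths_to G w" for r :: "('v, 'e, 'k) lfree" and x
  proof -
    have s: "free_act G r (Poly_Mapping.single q 1) = 0" if q: "q \<in> paths_to G w" for q
    proof -
      obtain y p where yp: "q = (y, p)" by force
      note S = free_act_minus free_act_mult free_act_sum paths_to_Cons[OF G] paths_to_Nil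
      show ?thesis using r q unfolding lrels_def yp
      proof (elim UnE CollectE exE conjE, goal_cases)
        case (7 u)
        show ?case
        proof (cases p)
          case Nil
          then show ?thesis using 7 w by (auto simp: S is_sink_def regular_def)
        next
          case (Cons f p')
          have "(\<Sum>e\<in>out_arcs G u. lin_ext (gen_act G (Ed e)) (lin_ext (gen_act G (Gh e)) (Poly_Mapping.single (y, p) (1::'k))))
              = (\<Sum>e\<in>out_arcs G u. if e = f then Poly_Mapping.single (y, p) 1 else 0)"
            using 7 Cons by (intro sum.cong) (auto simp: S)
          also have "\<dots> = (if u = y then Poly_Mapping.single (y, p) 1 else 0)"
            using 7 Cons by (auto simp: S regular_def sum.delta)
          finally show ?thesis using 7 by (simp add: S)
        qed
      next
        case 1 then show ?case by (auto simp: S)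
      next
        case 2 then show ?case by (auto simp: S)
      next
        case 3 then show ?case by (auto simp: S)
      next
        case 4 then show ?case by (cases p) (auto simp: S)
      next
        case 5 then show ?case by (cases p) (auto simp: S)
      next
        case 6 then show ?case by (auto simp: S)
      qed
    qed
    have "free_act G r x = free_act G r (\<Sum>b\<in>Poly_Mapping.keys x. pm_scale (Poly_Mapping.lookup x b) (Poly_Mapping.single b 1))"
      by (rule arg_cong[where f = "free_act G r"], rule trans[OF pm_expand]) simp
    also have "\<dots> = 0"
      unfolding free_act_sum_right free_act_scale_right using s x by (intro sum.neutral) auto
    finally show ?thesis .
  qed
  then have "lrels G \<subseteq> ?J" using lrels_carrier[OF G] by auto
  then have "h \<in> ?J" using alg_ideal_gen_least[OF J] h unfolding rel_ideal_def by blast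
  then show ?thesis using x by blast
qed

lemma N_mod_act:
  assumes G: "wf_digraph G" and w: "is_sink G w" and x: "x \<in> carrier (N_mod G w)"
  shows "lcls G a \<odot>\<^bsub>N_mod G w\<^esub> x = free_act G a x"
proof -
  have "the_elem ((\<lambda>a. free_act G a x) ` lcls G a) = free_act G a x"
    by (rule lcls_the_elem[OF G, where F = "\<lambda>a. free_act G a x"])
       (use x in \<open>simp add: free_act_add rel_act[OF G w] N_mod_def\<close>)
  then show ?thesis by (simp add: N_mod_def)
qed

subsection \<open>The situation of the theorem\<close>

lemma H_of_hereditary:
  assumes E: "wf_digraph E" shows "hereditary E (H_of E v)"
proof -
  interpret wf_digraph E by fact
  have "connects E u w" if "connects E u x" "connects E x w" for u x w
    using that unfolding connects_def by (meson awalk_appendI)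
  moreover have "connects E u x \<Longrightarrow> x \<in> verts E" for u x unfolding connects_def by (auto intro: awalk_last_in_verts)
  ultimately show ?thesis by (auto simp: hereditary_def H_of_def)
qed

lemma H_of_saturated:
  assumes E: "wf_digraph E" and v: "infinite_emitter E v"
  shows "saturated E (H_of E v)"
  unfolding saturated_def
proof (intro allI impI)
  fix u assume u: "regular E u" and s: "head E ` out_arcs E u \<subseteq> H_of E v"
  interpret wf_digraph E by fact
  have "\<not> connects E u v"
  proof
    assume "connects E u v"
    then obtain p where p: "awalk u p v" by (auto simp: connects_def)
    show False
    proof (cases p)
      case Nil then show False using p u v by (auto simp: awalk_def regular_def infinite_emitter_def)
    next
      case (Cons e p')
      then have "e \<in> out_arcs E u" "awalk (head E e) p' v" using p by (auto simp: awalk_def)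
      then have "head E e \<in> H_of E v" "connects E (head E e) v" using s unfolding connects_def by auto
      then show False by (auto simp: H_of_def)
    qed
  qed
  then show "u \<in> H_of E v" using u by (auto simp: H_of_def regular_def)
qed

lemma v_sink:
  assumes E: "wf_digraph E" and v: "infinite_emitter E v" "head E ` out_arcs E v \<subseteq> H_of E v"
  shows "is_sink (quot_graph E (H_of E v)) v"
proof -
  interpret wf_digraph E by fact
  have "connects E v v" using v(1) by (auto simp: connects_def awalk_def infinite_emitter_def intro!: exI[of _ "[]"])
  then show ?thesis using v by (auto simp: is_sink_def quot_graph_def H_of_def out_arcs_def infinite_emitter_def)
qed

lemma NH_mod_act:
  assumes E: "wf_digraph E" and v: "infinite_emitter E v" "head E ` out_arcs E v \<subseteq> H_of E v"
    and x: "x \<in> carrier (NH_mod E v)"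
  shows "lcls E a \<odot>\<^bsub>NH_mod E v\<^esub> x
       = free_act (quot_graph E (H_of E v)) (free_lift (quot_gen E (H_of E v)) a) x"
  using x v_sink[OF E v]
  by (simp add: NH_mod_def restrict_scalars_def quot_map_lcls[OF E H_of_hereditary[OF E] H_of_saturated[OF E v(1)]]
        N_mod_act[OF quot_graph_wf[OF E H_of_hereditary[OF E]]])

end

theory Submission
  imports Defs
begin

text \<open>
  Write \<open>H = H(v)\<close> and let \<open>G\<close> be the quotient graph \<open>E \ (H, B\<^sub>H)\<close>. An element of \<open>L\<^sub>K(E)\<close> acts on
  \<open>N\<^sub>v\<^sup>H\<close> through its image in \<open>L\<^sub>K(G)\<close>, so the annihilator is the preimage of the annihilator of
  \<open>N\<^sub>v\<close> in \<open>L\<^sub>K(G)\<close>. The generators of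
  \<open>I(H, B\<^sub>H)\<close> have image \<open>0\<close> in \<open>L\<^sub>K(G)\<close>, so they annihilate; two facts give the other inclusion.

  \<^item> If every vertex of a graph \<open>G\<close> has a path to a sink \<open>v\<close>, then \<open>L\<^sub>K(G)\<close> acts faithfully on \<open>N\<^sub>v\<close>
    (\<open>sink_module_faithful\<close>). The graph \<open>G\<close> above has this property by the definition of \<open>H(v)\<close>, as a
    path of \<open>E\<close> that ends in \<open>v\<close> never meets \<open>H(v)\<close>.

  \<^item> The kernel of \<open>L\<^sub>K(E) \<rightarrow> L\<^sub>K(G)\<close> lies in every ideal that contains \<open>H\<close> and the elements \<open>u\<^sup>H\<close>
    (\<open>ideal_contains_quot_kernel\<close>): modulo such an ideal the relations of \<open>G\<close> hold, the
    relation at a regular vertex \<open>u\<close> of \<open>G\<close> being either a relation of \<open>E\<close> or \<open>u\<^sup>H = 0\<close>.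

  Faithfulness is proved by induction on the length of ghost paths. Every element of \<open>L\<^sub>K(G)\<close>
  is a combination of products \<open>\<alpha>\<beta>\<^sup>*\<close> of paths and ghost paths, hence has the form
  \<open>a = p + \<Sum>\<^sub>e\<^sub>\<in>\<^sub>F b\<^sub>e e\<^sup>*\<close> with a combination \<open>p\<close> of real paths, a finite set \<open>F\<close> of edges, and
  \<open>b\<^sub>e\<close> with shorter ghost paths than \<open>a\<close>. Suppose that \<open>a\<close> kills \<open>N\<^sub>v\<close>. Then so does
  \<open>a e = p e + b\<^sub>e r(e)\<close> for \<open>e \<in> F\<close>, and induction on the ghost length gives \<open>a e = 0\<close>, that is
  \<open>b\<^sub>e e\<^sup>* = - p e e\<^sup>*\<close>. Therefore \<open>a = p - \<Sum>\<^sub>e\<^sub>\<in>\<^sub>F p e e\<^sup>*\<close>. If \<open>q\<close> is a path from \<open>w\<close> to \<open>v\<close> whose first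
  edge is outside \<open>F\<close>, or \<open>q = w = v\<close>, then \<open>a q = p q\<close>, and the paths \<open>\<alpha> q\<close> are distinct basis
  elements of \<open>N\<^sub>v\<close>; so \<open>p\<close> has no term that ends in \<open>w\<close>. For the other end points \<open>w\<close> there is no such
  \<open>q\<close>, which means that \<open>w \<noteq> v\<close> and all edges from \<open>w\<close> are in \<open>F\<close>. As some path leads
  from \<open>w\<close> to \<open>v\<close>, the vertex \<open>w\<close> is regular, and
  \<open>\<alpha> - \<Sum>\<^sub>e\<^sub>\<in>\<^sub>F \<alpha> e e\<^sup>* = 0\<close> for a path \<open>\<alpha>\<close> ending in \<open>w\<close> by the relation at \<open>w\<close>. Thus \<open>a = 0\<close>.
\<close>

section \<open>Congruence modulo the Leavitt relations\<close>

context wf_digraph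
begin

abbreviation lfree_carrier :: "('a, 'b, 'k::field) lfree set" where
  "lfree_carrier \<equiv> carrier (free_alg (lgens G))"

text \<open>
  Equality of classes in \<open>L\<^sub>K(G)\<close>, restricted to the free algebra on the generators of \<open>G\<close>. As a
  partial equivalence relation it records membership in that algebra, so calculations need no
  separate side conditions.
\<close>

definition lcong :: "('a, 'b, 'k::field) lfree \<Rightarrow> ('a, 'b, 'k) lfree \<Rightarrow> bool" (infix "\<sim>" 50) where
  "a \<sim> b \<longleftrightarrow> a \<in> lfree_carrier \<and> b \<in> lfree_carrier \<and> a - b \<in> rel_ideal G"

lemma lcong_carrier: "a \<sim> b \<Longrightarrow> a \<in> lfree_carrier" "a \<sim> b \<Longrightarrow> b \<in> lfree_carrier"
  by (auto simp: lcong_def)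

lemmas rel_ideal_closed = rel_idealD[OF wf_digraph_axioms]

lemma lcong_refl [intro]: "a \<in> lfree_carrier \<Longrightarrow> a \<sim> a"
  by (simp add: lcong_def rel_ideal_closed)

lemma lcong_sym: "a \<sim> b \<Longrightarrow> b \<sim> a"
  using rel_ideal_closed(3)[of 0 "a - b"] by (auto simp: lcong_def rel_ideal_closed(1))

lemma lcong_trans [trans]: "a \<sim> b \<Longrightarrow> b \<sim> c \<Longrightarrow> a \<sim> c"
  using rel_ideal_closed(2)[of "a - b" "b - c"] by (auto simp: lcong_def)

lemma lcong_add: "a \<sim> b \<Longrightarrow> c \<sim> d \<Longrightarrow> a + c \<sim> b + d"
  using rel_ideal_closed(2)[of "a - b" "c - d"] by (auto simp: lcong_def free_alg_closed algebra_simps)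

lemma lcong_minus: "a \<sim> b \<Longrightarrow> c \<sim> d \<Longrightarrow> a - c \<sim> b - d"
  using rel_ideal_closed(3)[of "a - b" "c - d"] by (auto simp: lcong_def free_alg_closed algebra_simps)

lemma lcong_scale: "a \<sim> b \<Longrightarrow> pm_scale c a \<sim> pm_scale c b"
  using rel_ideal_closed(4)[of "a - b" c] by (auto simp: lcong_def free_alg_closed)

lemma lcong_mult:
  assumes "a \<sim> b" "c \<sim> d"
  shows "a * c \<sim> b * d"
proof -
  have "a * c - b * d = (a - b) * c + b * (c - d)" by (simp add: algebra_simps)
  also have "\<dots> \<in> rel_ideal G"
    using assms by (intro rel_ideal_closed(2) rel_ideal_closed(5) rel_ideal_closed(6)) (auto simp: lcong_def)
  finally show ?thesis using assms by (simp add: lcong_def free_alg_closed)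
qed

lemma lcong_mult_left: "a \<in> lfree_carrier \<Longrightarrow> c \<sim> d \<Longrightarrow> a * c \<sim> a * d"
  and lcong_mult_right: "a \<in> lfree_carrier \<Longrightarrow> c \<sim> d \<Longrightarrow> c * a \<sim> d * a"
  by (auto intro: lcong_mult)

lemma lcong_sum: "(\<And>i. i \<in> S \<Longrightarrow> f i \<sim> g i) \<Longrightarrow> (\<Sum>i\<in>S. f i) \<sim> (\<Sum>i\<in>S. g i)"
  by (induction S rule: infinite_finite_induct) (auto intro: lcong_add free_alg_closed)

lemma lcong_0_iff: "a \<sim> 0 \<longleftrightarrow> a \<in> rel_ideal G"
  by (auto simp: lcong_def free_alg_closed rel_ideal_closed(7))

lemma gen_in_carrier:
  "u \<in> verts G \<Longrightarrow> gen (Vx u) \<in> lfree_carrier"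
  "e \<in> arcs G \<Longrightarrow> gen (Ed e) \<in> lfree_carrier"
  "e \<in> arcs G \<Longrightarrow> gen (Gh e) \<in> lfree_carrier"
  by (simp_all add: gen_carrier)

lemmas carrier_intros = gen_in_carrier free_alg_closed free_alg_sum

lemma lcong_rels:
  "u \<in> verts G \<Longrightarrow> w \<in> verts G \<Longrightarrow> gen (Vx u) * gen (Vx w) \<sim> (if u = w then gen (Vx u) else 0)"
  "e \<in> arcs G \<Longrightarrow> gen (Vx (tail G e)) * gen (Ed e) \<sim> gen (Ed e)"
  "e \<in> arcs G \<Longrightarrow> gen (Ed e) * gen (Vx (head G e)) \<sim> gen (Ed e)"
  "e \<in> arcs G \<Longrightarrow> gen (Vx (head G e)) * gen (Gh e) \<sim> gen (Gh e)"
  "e \<in> arcs G \<Longrightarrow> gen (Gh e) * gen (Vx (tail G e)) \<sim> gen (Gh e)"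
  "e \<in> arcs G \<Longrightarrow> f \<in> arcs G \<Longrightarrow> gen (Gh e) * gen (Ed f) \<sim> (if e = f then gen (Vx (head G e)) else 0)"
  "regular G u \<Longrightarrow> gen (Vx u) \<sim> (\<Sum>e\<in>out_arcs G u. gen (Ed e) * gen (Gh e))"
  unfolding lcong_def by (intro conjI rel_ideal_rels; auto intro!: carrier_intros simp: regular_def)+

lemma lcong_Vx_Ed:
  assumes "u \<in> verts G" "e \<in> arcs G"
  shows "gen (Vx u) * gen (Ed e) \<sim> (if u = tail G e then gen (Ed e) else 0)"
proof (cases "u = tail G e")
  case True
  then show ?thesis using lcong_rels(2)[OF assms(2)] by simp
next
  case False
  have "gen (Vx u) * gen (Ed e) \<sim> gen (Vx u) * (gen (Vx (tail G e)) * gen (Ed e))"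
    by (rule lcong_mult_left[OF _ lcong_sym[OF lcong_rels(2)]]) (use assms in \<open>auto intro: carrier_intros\<close>)
  also have "\<dots> = (gen (Vx u) * gen (Vx (tail G e))) * gen (Ed e)" by (simp add: mult.assoc)
  also have "\<dots> \<sim> 0 * gen (Ed e)"
    using lcong_mult_right[OF gen_in_carrier(2)[OF assms(2)] lcong_rels(1)[OF assms(1), of "tail G e"]] False assms by simp
  finally show ?thesis using False by simp
qed

lemma lcong_Gh_Vx:
  assumes "u \<in> verts G" "e \<in> arcs G"
  shows "gen (Gh e) * gen (Vx u) \<sim> (if u = tail G e then gen (Gh e) else 0)"
proof (cases "u = tail G e")
  case True
  then show ?thesis using lcong_rels(5)[OF assms(2)] by simp
next
  case False
  have "gen (Gh e) * gen (Vx u) \<sim> (gen (Gh e) * gen (Vx (tail G e))) * gen (Vx u)"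
    by (rule lcong_mult_right[OF _ lcong_sym[OF lcong_rels(5)]]) (use assms in \<open>auto intro: carrier_intros\<close>)
  also have "\<dots> = gen (Gh e) * (gen (Vx (tail G e)) * gen (Vx u))" by (simp add: mult.assoc)
  also have "\<dots> \<sim> gen (Gh e) * 0"
    using lcong_mult_left[OF gen_in_carrier(3)[OF assms(2)] lcong_rels(1)[OF _ assms(1), of "tail G e"]] False assms by simp
  finally show ?thesis using False by simp
qed

section \<open>Real paths\<close>

fun path_elem :: "('a, 'b) lpath \<Rightarrow> ('a, 'b, 'k::field) lfree" where
  "path_elem (x, []) = gen (Vx x)"
| "path_elem (x, e # l) = gen (Ed e) * path_elem (head G e, l)"

lemmas paths_to_iff = paths_to_Cons[OF wf_digraph_axioms] paths_to_Nil

lemma paths_to_end_unique: "(x, l) \<in> paths_to G w \<Longrightarrow> (x, l) \<in> paths_to G w' \<Longrightarrow> w = w'"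
  by (induction l arbitrary: x) (auto simp: paths_to_iff)

lemma paths_to_end_vert: "(x, l) \<in> paths_to G w \<Longrightarrow> w \<in> verts G"
  by (induction l arbitrary: x) (auto simp: paths_to_iff)

lemma paths_to_snoc: "(x, l) \<in> paths_to G (tail G e) \<Longrightarrow> e \<in> arcs G \<Longrightarrow> (x, l @ [e]) \<in> paths_to G (head G e)"
  by (induction l arbitrary: x) (auto simp: paths_to_iff)

lemma path_elem_carrier: "(x, l) \<in> paths_to G w \<Longrightarrow> path_elem (x, l) \<in> lfree_carrier"
  by (induction l arbitrary: x) (auto simp: paths_to_iff intro!: carrier_intros)

lemma path_elem_Vx:
  assumes "(x, l) \<in> paths_to G w" "u \<in> verts G"
  shows "path_elem (x, l) * gen (Vx u) \<sim> (if u = w then path_elem (x, l) else 0)"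
  using assms(1)
proof (induction l arbitrary: x)
  case Nil
  then show ?case using lcong_rels(1)[of x u] assms(2) by (auto simp: paths_to_iff)
next
  case (Cons e l)
  then have e: "e \<in> arcs G" and l: "(head G e, l) \<in> paths_to G w" by (auto simp: paths_to_iff)
  show ?case
    using lcong_mult_left[OF gen_in_carrier(2)[OF e] Cons.IH[OF l]] by (simp add: mult.assoc split: if_splits)
qed

lemma path_elem_Ed:
  assumes "(x, l) \<in> paths_to G w" "f \<in> arcs G"
  shows "path_elem (x, l) * gen (Ed f) \<sim> (if tail G f = w then path_elem (x, l @ [f]) else 0)"
  using assms(1)
proof (induction l arbitrary: x)
  case Nil
  then have x: "x = w" "w \<in> verts G" by (auto simp: paths_to_iff)
  show ?case
    using lcong_Vx_Ed[OF x(2) assms(2)] lcong_trans[OF lcong_Vx_Ed[OF x(2) assms(2)], of "gen (Ed f) * gen (Vx (head G f))"]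
      lcong_sym[OF lcong_rels(3)[OF assms(2)]] x(1) by (auto split: if_splits)
next
  case (Cons e l)
  then have e: "e \<in> arcs G" and l: "(head G e, l) \<in> paths_to G w" by (auto simp: paths_to_iff)
  show ?case
    using lcong_mult_left[OF gen_in_carrier(2)[OF e] Cons.IH[OF l]] by (simp add: mult.assoc split: if_splits)
qed

lemma path_elem_act:
  assumes "(x, l) \<in> paths_to G w"
  shows "free_act G (path_elem (x, l)) (Poly_Mapping.single (y, q) (1::'k::field)) =
    (if y = w then Poly_Mapping.single (x, l @ q) 1 else 0)"
  using assms
  by (induction l arbitrary: x) (auto simp: paths_to_iff free_act_mult)

definition path_span :: "('a, 'b, 'k::field) lfree set" where
  "path_span = {a. \<exists>P. Poly_Mapping.keys P \<subseteq> (\<Union>w. paths_to G w) \<and> a \<sim> lin_ext path_elem P}"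

lemma path_span_carrier: "a \<in> path_span \<Longrightarrow> a \<in> lfree_carrier"
  by (auto simp: path_span_def lcong_carrier)

lemma path_span_cong: "a \<sim> b \<Longrightarrow> b \<in> path_span \<Longrightarrow> a \<in> path_span"
  by (auto simp: path_span_def intro: lcong_trans)

lemma path_span_path: "(x, l) \<in> paths_to G w \<Longrightarrow> path_elem (x, l) \<in> path_span"
  unfolding path_span_def
  by (rule CollectI, rule exI[of _ "Poly_Mapping.single (x, l) 1"]) (auto intro: path_elem_carrier)

lemma path_span_0: "0 \<in> path_span"
  unfolding path_span_def by (rule CollectI, rule exI[of _ 0]) (auto intro: free_alg_closed)

lemma path_span_add: "a \<in> path_span \<Longrightarrow> b \<in> path_span \<Longrightarrow> a + b \<in> path_span"
  unfolding path_span_def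
proof (elim CollectE exE conjE, goal_cases)
  case (1 P Q)
  then show ?case
    using keys_add[of P Q] by (intro CollectI exI[of _ "P + Q"]) (auto simp: lin_ext_add intro: lcong_add)
qed

lemma path_span_scale: "a \<in> path_span \<Longrightarrow> pm_scale c a \<in> path_span"
  unfolding path_span_def
proof (elim CollectE exE conjE, goal_cases)
  case (1 P)
  then show ?case
    using keys_pm_scale[of c P] by (intro CollectI exI[of _ "pm_scale c P"]) (auto simp: lin_ext_scale intro: lcong_scale)
qed

lemma path_span_sum: "(\<And>i. i \<in> S \<Longrightarrow> f i \<in> path_span) \<Longrightarrow> (\<Sum>i\<in>S. f i) \<in> path_span"
  by (induction S rule: infinite_finite_induct) (auto intro: path_span_0 path_span_add)

lemma path_span_mult:
  assumes "a \<in> path_span" and g: "g \<in> lfree_carrier"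
    and *: "\<And>x l w. (x, l) \<in> paths_to G w \<Longrightarrow> path_elem (x, l) * g \<in> path_span"
  shows "a * g \<in> path_span"
proof -
  obtain P where P: "Poly_Mapping.keys P \<subseteq> (\<Union>w. paths_to G w)" "a \<sim> lin_ext path_elem P"
    using assms(1) by (auto simp: path_span_def)
  have "a * g \<sim> lin_ext path_elem P * g" by (rule lcong_mult_right[OF g P(2)])
  moreover have "lin_ext path_elem P * g = (\<Sum>q\<in>Poly_Mapping.keys P. pm_scale (Poly_Mapping.lookup P q) (path_elem q * g))"
    by (simp add: lin_ext_def sum_distrib_right pm_scale_mult(1))
  moreover have "\<dots> \<in> path_span"
    using P(1) * by (intro path_span_sum path_span_scale) fast
  ultimately show ?thesis by (metis path_span_cong)
qed

lemma path_span_Vx: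
  assumes "a \<in> path_span" "u \<in> verts G" shows "a * gen (Vx u) \<in> path_span"
  using assms(1)
proof (rule path_span_mult)
  fix x l w assume "(x, l) \<in> paths_to G w"
  then show "path_elem (x, l) * gen (Vx u) \<in> path_span"
    by (intro path_span_cong[OF path_elem_Vx[OF _ assms(2)]]) (auto intro: path_span_0 path_span_path)
qed (use assms in \<open>auto intro: carrier_intros\<close>)

lemma path_span_Ed:
  assumes "a \<in> path_span" "e \<in> arcs G" shows "a * gen (Ed e) \<in> path_span"
  using assms(1)
proof (rule path_span_mult)
  fix x l w assume "(x, l) \<in> paths_to G w"
  then show "path_elem (x, l) * gen (Ed e) \<in> path_span"
    by (intro path_span_cong[OF path_elem_Ed[OF _ assms(2)]])
       (auto intro: path_span_0 path_span_path paths_to_snoc assms(2))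
qed (use assms in \<open>auto intro: carrier_intros\<close>)

section \<open>The filtration by ghost length\<close>

text \<open>
  \<open>ghost_filt n\<close> consists of the combinations of products \<open>\<alpha>\<beta>\<^sup>*\<close> with \<open>\<beta>\<close> of length at most \<open>n\<close>. The
  recursion collects the terms according to the first edge \<open>e\<close> of \<open>\<beta>\<close>, since \<open>(e\<beta>')\<^sup>* = \<beta>'\<^sup>*e\<^sup>*\<close>. The
  coefficients \<open>b e\<close> vanish outside \<open>F\<close> so that two such sums can be added over the union of their
  index sets.
\<close>

primrec ghost_filt :: "nat \<Rightarrow> ('a, 'b, 'k::field) lfree set" where
  "ghost_filt 0 = path_span"
| "ghost_filt (Suc n) = {a. \<exists>p F b. p \<in> path_span \<and> finite F \<and> F \<subseteq> arcs G \<and> (\<forall>e. b e \<in> ghost_filt n) \<and>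
      (\<forall>e. e \<notin> F \<longrightarrow> b e = 0) \<and> a \<sim> p + (\<Sum>e\<in>F. b e * gen (Gh e))}"

lemma ghost_filt_SucI:
  assumes "p \<in> path_span" "finite F" "F \<subseteq> arcs G" "\<And>e. b e \<in> ghost_filt n" "\<And>e. e \<notin> F \<Longrightarrow> b e = 0"
    "a \<sim> p + (\<Sum>e\<in>F. b e * gen (Gh e))"
  shows "a \<in> ghost_filt (Suc n)"
  using assms by auto

lemma ghost_filt_carrier: "a \<in> ghost_filt n \<Longrightarrow> a \<in> lfree_carrier"
  by (cases n) (auto simp: path_span_carrier lcong_carrier)

lemma ghost_filt_cong: "a \<sim> b \<Longrightarrow> b \<in> ghost_filt n \<Longrightarrow> a \<in> ghost_filt n"
proof (cases n)
  case 0
  assume "a \<sim> b" "b \<in> ghost_filt n"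
  then show ?thesis using 0 path_span_cong[of a b] by simp
next
  case (Suc m)
  assume ab: "a \<sim> b" and "b \<in> ghost_filt n"
  then obtain p F c where 1: "p \<in> path_span" "finite F" "F \<subseteq> arcs G" "\<forall>e. c e \<in> ghost_filt m" "\<forall>e. e \<notin> F \<longrightarrow> c e = 0"
    "b \<sim> p + (\<Sum>e\<in>F. c e * gen (Gh e))" using Suc by auto
  show ?thesis unfolding Suc by (rule ghost_filt_SucI[OF 1(1-3) _ _ lcong_trans[OF ab 1(6)]]) (use 1 in auto)
qed

lemma ghost_filt_add: "a \<in> ghost_filt n \<Longrightarrow> b \<in> ghost_filt n \<Longrightarrow> a + b \<in> ghost_filt n"
proof (induction n arbitrary: a b)
  case 0
  then show ?case by (simp add: path_span_add)
next
  case (Suc n)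
  obtain p F c where 1: "p \<in> path_span" "finite F" "F \<subseteq> arcs G" "\<forall>e. c e \<in> ghost_filt n" "\<forall>e. e \<notin> F \<longrightarrow> c e = 0"
    "a \<sim> p + (\<Sum>e\<in>F. c e * gen (Gh e))" using Suc.prems(1) by auto
  obtain p' F' d where 2: "p' \<in> path_span" "finite F'" "F' \<subseteq> arcs G" "\<forall>e. d e \<in> ghost_filt n" "\<forall>e. e \<notin> F' \<longrightarrow> d e = 0"
    "b \<sim> p' + (\<Sum>e\<in>F'. d e * gen (Gh e))" using Suc.prems(2) by auto
  have "(\<Sum>e\<in>F. c e * gen (Gh e)) = (\<Sum>e\<in>F \<union> F'. c e * gen (Gh e))"
    "(\<Sum>e\<in>F'. d e * gen (Gh e)) = (\<Sum>e\<in>F \<union> F'. d e * gen (Gh e))"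
    using 1 2 by (auto intro!: sum.mono_neutral_left)
  then have "a + b \<sim> (p + p') + (\<Sum>e\<in>F \<union> F'. (c e + d e) * gen (Gh e))"
    using lcong_add[OF 1(6) 2(6)] by (simp add: distrib_right sum.distrib algebra_simps)
  then show ?case
    using 1 2 Suc.IH by (intro ghost_filt_SucI[where p = "p + p'" and F = "F \<union> F'"]) (auto intro: path_span_add)
qed

lemma path_span_ghost_filt: "a \<in> path_span \<Longrightarrow> a \<in> ghost_filt n"
proof (induction n arbitrary: a)
  case (Suc n)
  show ?case
    by (rule ghost_filt_SucI[where p = a and F = "{}" and b = "\<lambda>_. 0"])
       (use Suc path_span_0 in \<open>auto intro: path_span_carrier\<close>)
qed simp

lemma ghost_filt_mono: "a \<in> ghost_filt n \<Longrightarrow> a \<in> ghost_filt (Suc n)"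
proof (induction n arbitrary: a)
  case 0
  then show ?case by (simp only: ghost_filt.simps(1) path_span_ghost_filt)
next
  case (Suc n)
  obtain p F c where 1: "p \<in> path_span" "finite F" "F \<subseteq> arcs G" "\<forall>e. c e \<in> ghost_filt n" "\<forall>e. e \<notin> F \<longrightarrow> c e = 0"
    "a \<sim> p + (\<Sum>e\<in>F. c e * gen (Gh e))" using Suc.prems by auto
  show ?case by (rule ghost_filt_SucI[OF 1(1-3) _ _ 1(6)]) (use 1 Suc.IH in auto)
qed

lemma ghost_filt_le: "n \<le> m \<Longrightarrow> a \<in> ghost_filt n \<Longrightarrow> a \<in> ghost_filt m"
  by (induction m rule: dec_induct) (auto simp del: ghost_filt.simps intro: ghost_filt_mono)

lemma ghost_filt_scale: "a \<in> ghost_filt n \<Longrightarrow> pm_scale c a \<in> ghost_filt n"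
proof (induction n arbitrary: a)
  case 0
  then show ?case by (simp add: path_span_scale)
next
  case (Suc n)
  obtain p F b where 1: "p \<in> path_span" "finite F" "F \<subseteq> arcs G" "\<forall>e. b e \<in> ghost_filt n" "\<forall>e. e \<notin> F \<longrightarrow> b e = 0"
    "a \<sim> p + (\<Sum>e\<in>F. b e * gen (Gh e))" using Suc.prems by auto
  have "pm_scale c a \<sim> pm_scale c p + (\<Sum>e\<in>F. pm_scale c (b e) * gen (Gh e))"
    using lcong_scale[OF 1(6), of c] by (simp add: pm_scale_sum pm_scale_mult(1))
  then show ?case using 1 Suc.IH
    by (intro ghost_filt_SucI[where p = "pm_scale c p" and F = F and b = "\<lambda>e. pm_scale c (b e)"]) (auto intro: path_span_scale)
qed

lemma ghost_filt_Gh: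
  assumes "a \<in> ghost_filt n" "e \<in> arcs G" shows "a * gen (Gh e) \<in> ghost_filt (Suc n)"
  by (rule ghost_filt_SucI[where p = 0 and F = "{e}" and b = "\<lambda>f. if f = e then a else 0"])
     (use assms in \<open>auto intro: path_span_0 path_span_ghost_filt carrier_intros ghost_filt_carrier\<close>)

lemma ghost_filt_Vx:
  assumes "a \<in> ghost_filt n" "u \<in> verts G" shows "a * gen (Vx u) \<in> ghost_filt n"
proof (cases n)
  case 0
  then show ?thesis using path_span_Vx assms by simp
next
  case (Suc m)
  obtain p F b where 1: "p \<in> path_span" "finite F" "F \<subseteq> arcs G" "\<forall>e. b e \<in> ghost_filt m" "\<forall>e. e \<notin> F \<longrightarrow> b e = 0"
    "a \<sim> p + (\<Sum>e\<in>F. b e * gen (Gh e))" using assms Suc by auto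
  define c where "c e = (if tail G e = u then b e else 0)" for e
  have "a * gen (Vx u) \<sim> (p + (\<Sum>e\<in>F. b e * gen (Gh e))) * gen (Vx u)"
    by (rule lcong_mult_right[OF gen_in_carrier(1)[OF assms(2)] 1(6)])
  also have "\<dots> = p * gen (Vx u) + (\<Sum>e\<in>F. b e * (gen (Gh e) * gen (Vx u)))"
    by (simp add: distrib_right sum_distrib_right mult.assoc)
  also have "\<dots> \<sim> p * gen (Vx u) + (\<Sum>e\<in>F. c e * gen (Gh e))"
  proof (intro lcong_add lcong_refl lcong_sum)
    fix e assume e: "e \<in> F"
    then have "e \<in> arcs G" "b e \<in> lfree_carrier" using 1 by (auto intro: ghost_filt_carrier)
    then show "b e * (gen (Gh e) * gen (Vx u)) \<sim> c e * gen (Gh e)"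
      using lcong_mult_left[OF _ lcong_Gh_Vx[OF assms(2)], of "b e" e] by (auto simp: c_def split: if_splits)
  qed (use 1 assms in \<open>auto intro: carrier_intros path_span_carrier\<close>)
  finally show ?thesis unfolding Suc
    by (rule ghost_filt_SucI[rotated -1]) (use 1 assms in \<open>auto simp: c_def intro: path_span_Vx path_span_0 path_span_ghost_filt\<close>)
qed

text \<open>
  Multiplication by \<open>f\<close> isolates one coefficient of a sum of ghost terms, because \<open>e\<^sup>*f = 0\<close> for
  \<open>e \<noteq> f\<close> and \<open>f\<^sup>*f = r(f)\<close>.
\<close>

lemma ghost_sum_Ed:
  assumes p: "p \<in> lfree_carrier" and F: "finite F" "F \<subseteq> arcs G" and b: "\<And>e. b e \<in> lfree_carrier"
    "\<And>e. e \<notin> F \<Longrightarrow> b e = 0"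
    and a: "a \<sim> p + (\<Sum>e\<in>F. b e * gen (Gh e))" and f: "f \<in> arcs G"
  shows "a * gen (Ed f) \<sim> p * gen (Ed f) + b f * gen (Vx (head G f))"
proof -
  have "a * gen (Ed f) \<sim> (p + (\<Sum>e\<in>F. b e * gen (Gh e))) * gen (Ed f)"
    by (rule lcong_mult_right[OF gen_in_carrier(2)[OF f] a])
  also have "\<dots> = p * gen (Ed f) + (\<Sum>e\<in>F. b e * (gen (Gh e) * gen (Ed f)))"
    by (simp add: distrib_right sum_distrib_right mult.assoc)
  also have "\<dots> \<sim> p * gen (Ed f) + (\<Sum>e\<in>F. if e = f then b f * gen (Vx (head G f)) else 0)"
  proof (intro lcong_add lcong_refl lcong_sum)
    fix e assume "e \<in> F"
    then have "e \<in> arcs G" using F by auto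
    from lcong_mult_left[OF b(1) lcong_rels(6)[OF this f], of e]
    show "b e * (gen (Gh e) * gen (Ed f)) \<sim> (if e = f then b f * gen (Vx (head G f)) else 0)"
      by (auto split: if_splits)
  qed (use p f in \<open>auto intro: carrier_intros\<close>)
  also have "(\<Sum>e\<in>F. if e = f then b f * gen (Vx (head G f)) else 0) = b f * gen (Vx (head G f))"
    using F(1) b(2)[of f] by (auto simp: sum.delta)
  finally show ?thesis .
qed

text \<open>
  Right multiplication by an edge cancels one ghost edge. This is what makes the induction on the
  ghost length possible.
\<close>

lemma ghost_filt_Ed:
  assumes "a \<in> ghost_filt (Suc n)" "f \<in> arcs G" shows "a * gen (Ed f) \<in> ghost_filt n"
proof -
  obtain p F b where 1: "p \<in> path_span" "finite F" "F \<subseteq> arcs G" "\<forall>e. b e \<in> ghost_filt n" "\<forall>e. e \<notin> F \<longrightarrow> b e = 0"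
    "a \<sim> p + (\<Sum>e\<in>F. b e * gen (Gh e))" using assms by auto
  have "a * gen (Ed f) \<sim> p * gen (Ed f) + b f * gen (Vx (head G f))"
    by (rule ghost_sum_Ed[OF _ 1(2,3) _ _ 1(6) assms(2)]) (use 1 in \<open>auto intro: path_span_carrier ghost_filt_carrier\<close>)
  then show ?thesis
    by (rule ghost_filt_cong)
       (use 1 assms(2) in \<open>auto intro!: ghost_filt_add path_span_ghost_filt[OF path_span_Ed] ghost_filt_Vx\<close>)
qed

text \<open>
  The union of the filtration contains the generators, and right multiplication by a generator
  stays within it; hence it contains all words.
\<close>

lemma ghost_filt_exhausts:
  fixes a :: "('a, 'b, 'k::field) lfree"
  assumes "a \<in> lfree_carrier" shows "\<exists>n. a \<in> ghost_filt n"
proof -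
  have word: "\<exists>n. Poly_Mapping.single (Word l) (1::'k) \<in> ghost_filt n" if "l \<noteq> []" "set l \<subseteq> lgens G" for l
    using that
  proof (induction l rule: rev_nonempty_induct)
    case (single g)
    then consider (V) u where "g = Vx u" "u \<in> verts G" | (E) e where "g = Ed e" "e \<in> arcs G" | (H) e where "g = Gh e" "e \<in> arcs G"
      by (auto simp: lgens_def)
    then have "\<exists>n. gen g \<in> (ghost_filt n :: ('a, 'b, 'k) lfree set)"
    proof cases
      case V
      then show ?thesis using path_span_path[of u "[]" u] by (auto simp: paths_to_iff intro!: exI[of _ 0])
    next
      case E
      have "gen (Ed e) \<in> (path_span :: ('a, 'b, 'k) lfree set)"
        using path_span_path[of "tail G e" "[e]" "head G e"] E
        by (intro path_span_cong[OF lcong_sym[OF lcong_rels(3)]]) (auto simp: paths_to_iff)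
      then show ?thesis using E by (auto intro!: exI[of _ 0])
    next
      case H
      have "gen (Vx (head G e)) \<in> (path_span :: ('a, 'b, 'k) lfree set)"
        using path_span_path[of "head G e" "[]" "head G e"] H by (auto simp: paths_to_iff)
      then have "gen (Vx (head G e)) * gen (Gh e) \<in> (ghost_filt (Suc 0) :: ('a, 'b, 'k) lfree set)"
        using H by (intro ghost_filt_Gh) simp_all
      then have "gen (Gh e) \<in> (ghost_filt (Suc 0) :: ('a, 'b, 'k) lfree set)"
        using H by (intro ghost_filt_cong[OF lcong_sym[OF lcong_rels(4)]])
      then show ?thesis using H by blast
    qed
    then show ?case by (simp add: gen_def)
  next
    case (snoc g l)
    then obtain n where n: "Poly_Mapping.single (Word l) (1::'k) \<in> ghost_filt n" by auto
    consider (V) u where "g = Vx u" "u \<in> verts G" | (E) e where "g = Ed e" "e \<in> arcs G" | (H) e where "g = Gh e" "e \<in> arcs G"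
      using snoc.prems by (auto simp: lgens_def)
    then have "\<exists>m. Poly_Mapping.single (Word l) (1::'k) * gen g \<in> ghost_filt m"
    proof cases
      case V then show ?thesis using ghost_filt_Vx[OF n] by auto
    next
      case E then show ?thesis using ghost_filt_Ed[OF ghost_filt_mono[OF n]] by auto
    next
      case H then show ?thesis using ghost_filt_Gh[OF n] by blast
    qed
    then show ?case by (simp add: gen_def mult_single plus_word_def)
  qed
  have "\<exists>n. (\<Sum>w\<in>S. Poly_Mapping.single w (Poly_Mapping.lookup a w)) \<in> ghost_filt n"
    if "finite S" "S \<subseteq> Poly_Mapping.keys a" for S
    using that
  proof (induction S rule: finite_induct)
    case empty
    show ?case using path_span_0 by (auto intro!: exI[of _ 0])
  next
    case (insert w S)
    then obtain n where n: "(\<Sum>w\<in>S. Poly_Mapping.single w (Poly_Mapping.lookup a w)) \<in> ghost_filt n" by auto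
    obtain m where "Poly_Mapping.single w 1 \<in> (ghost_filt m :: ('a, 'b, 'k) lfree set)"
      using word[of "letters w"] assms insert.prems by (auto simp: free_alg_carrier)
    from ghost_filt_scale[OF this, of "Poly_Mapping.lookup a w"]
    have m: "Poly_Mapping.single w (Poly_Mapping.lookup a w) \<in> ghost_filt m" by simp
    show ?case using ghost_filt_add[OF ghost_filt_le[OF max.cobounded1 m] ghost_filt_le[OF max.cobounded2 n]] insert.hyps by auto
  qed
  from this[of "Poly_Mapping.keys a"] show ?thesis by (simp only: pm_expand[of a, symmetric] finite_keys subset_refl simp_thms)
qed

section \<open>Faithfulness\<close>

text \<open>
  Appending a fixed path \<open>q\<close> is injective on paths, so the coefficients of the paths that end where
  \<open>q\<close> starts can be read off from the action on \<open>q\<close>.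
\<close>

lemma path_part_act:
  fixes P :: "('a, 'b) lpath \<Rightarrow>\<^sub>0 'k::field"
  assumes P: "Poly_Mapping.keys P \<subseteq> (\<Union>w. paths_to G w)"
    and xl: "(x, l) \<in> paths_to G y"
  shows "Poly_Mapping.lookup (free_act G (lin_ext path_elem P) (Poly_Mapping.single (y, q) 1)) (x, l @ q)
    = Poly_Mapping.lookup P (x, l)"
proof -
  have act: "free_act G (path_elem r) (Poly_Mapping.single (y, q) (1::'k)) =
      (if r \<in> paths_to G y then Poly_Mapping.single (fst r, snd r @ q) 1 else 0)"
    if "r \<in> Poly_Mapping.keys P" for r
  proof -
    obtain z m where r: "r = (z, m)" by force
    from that P obtain w where "(z, m) \<in> paths_to G w" by (auto simp: r)
    from path_elem_act[OF this, of y q] this show ?thesis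
      using paths_to_end_unique[of z m w y] by (auto simp: r)
  qed
  have "Poly_Mapping.lookup (free_act G (lin_ext path_elem P) (Poly_Mapping.single (y, q) 1)) (x, l @ q)
     = (\<Sum>r\<in>Poly_Mapping.keys P. Poly_Mapping.lookup P r *
         Poly_Mapping.lookup (free_act G (path_elem r) (Poly_Mapping.single (y, q) 1)) (x, l @ q))"
    by (simp add: lin_ext_def free_act_sum free_act_scale lookup_sum)
  also have "\<dots> = (\<Sum>r\<in>Poly_Mapping.keys P. if r = (x, l) then Poly_Mapping.lookup P (x, l) else 0)"
    using xl by (intro sum.cong refl) (auto simp: act lookup_single when_def)
  also have "\<dots> = Poly_Mapping.lookup P (x, l)"
    by (auto simp: sum.delta in_keys_iff)
  finally show ?thesis .
qed

text \<open>
  Edges in \<open>F\<close> that do not start in \<open>w\<close> contribute nothing, and the others sum up to \<open>w\<close> by the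
  relation at the regular vertex \<open>w\<close>.
\<close>

lemma path_elem_regular_end:
  fixes F :: "'b set"
  assumes xl: "(x, l) \<in> paths_to G w" and w: "regular G w" and F: "finite F" "F \<subseteq> arcs G" "out_arcs G w \<subseteq> F"
  shows "path_elem (x, l) - (\<Sum>e\<in>F. path_elem (x, l) * (gen (Ed e) * gen (Gh e))) \<sim> (0 :: ('a, 'b, 'k::field) lfree)"
proof -
  let ?a = "path_elem (x, l) :: ('a, 'b, 'k) lfree"
  have a: "?a \<in> lfree_carrier" by (rule path_elem_carrier[OF xl])
  have wv: "w \<in> verts G" by (rule paths_to_end_vert[OF xl])
  have "?a \<sim> ?a * gen (Vx w)"
    using lcong_sym[OF path_elem_Vx[OF xl wv]] by simp
  also have "\<dots> \<sim> ?a * (\<Sum>e\<in>out_arcs G w. gen (Ed e) * gen (Gh e))"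
    by (rule lcong_mult_left[OF a lcong_rels(7)[OF w]])
  finally have 1: "?a \<sim> (\<Sum>e\<in>out_arcs G w. ?a * (gen (Ed e) * gen (Gh e)))"
    by (simp add: sum_distrib_left)
  have "(\<Sum>e\<in>F. ?a * (gen (Ed e) * gen (Gh e))) \<sim>
      (\<Sum>e\<in>F. if e \<in> out_arcs G w then ?a * (gen (Ed e) * gen (Gh e)) else 0)"
  proof (rule lcong_sum)
    fix e assume "e \<in> F"
    then have e: "e \<in> arcs G" using F by auto
    show "?a * (gen (Ed e) * gen (Gh e)) \<sim> (if e \<in> out_arcs G w then ?a * (gen (Ed e) * gen (Gh e)) else 0)"
    proof (cases "e \<in> out_arcs G w")
      case True
      then show ?thesis using a e by (auto intro!: lcong_refl carrier_intros)
    next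
      case False
      then show ?thesis
        using lcong_mult_right[OF gen_in_carrier(3)[OF e] path_elem_Ed[OF xl e]] e by (simp add: mult.assoc)
    qed
  qed
  also have "\<dots> = (\<Sum>e\<in>out_arcs G w. ?a * (gen (Ed e) * gen (Gh e)))"
    using F by (intro sum.mono_neutral_cong_right) auto
  finally have 2: "(\<Sum>e\<in>F. ?a * (gen (Ed e) * gen (Gh e))) \<sim> (\<Sum>e\<in>out_arcs G w. ?a * (gen (Ed e) * gen (Gh e)))" .
  show ?thesis
    using lcong_minus[OF 1 2] by (simp only: diff_self)
qed

text \<open>
  Testing on paths whose first edge avoids \<open>F\<close> shows that a real path can
  occur in \<open>p\<close> only if all edges from its end point lie in \<open>F\<close>; for these paths
  \<open>path_elem_regular_end\<close> applies.
\<close>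

lemma annihilating_path_part:
  fixes P :: "('a, 'b) lpath \<Rightarrow>\<^sub>0 'k::field"
  assumes reach: "\<And>w. w \<in> verts G \<Longrightarrow> \<exists>q. (w, q) \<in> paths_to G v"
    and P: "Poly_Mapping.keys P \<subseteq> (\<Union>w. paths_to G w)"
    and F: "finite F" "F \<subseteq> arcs G"
    and p: "p = lin_ext path_elem P"
    and kill: "\<And>r. r \<in> paths_to G v \<Longrightarrow>
      free_act G (p - (\<Sum>e\<in>F. p * (gen (Ed e) * gen (Gh e)))) (Poly_Mapping.single r 1) = 0"
  shows "p - (\<Sum>e\<in>F. p * (gen (Ed e) * gen (Gh e))) \<sim> 0"
proof -
  have local: "path_elem r - (\<Sum>e\<in>F. path_elem r * (gen (Ed e) * gen (Gh e))) \<sim> (0 :: ('a, 'b, 'k) lfree)"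
    if r: "r \<in> Poly_Mapping.keys P" for r
  proof -
    obtain x l where xl: "r = (x, l)" by force
    obtain w where w: "(x, l) \<in> paths_to G w" using P r xl by auto
    \<comment> \<open>On a path \<open>q\<close> that violates this, every \<open>e\<^sup>*\<close> with \<open>e \<in> F\<close> vanishes, so \<open>p\<close> itself kills \<open>q\<close>.\<close>
    have first_arc: "q \<noteq> [] \<and> hd q \<in> F" if q: "(w, q) \<in> paths_to G v" for q
    proof (rule ccontr)
      assume *: "\<not> (q \<noteq> [] \<and> hd q \<in> F)"
      have "gen_act G (Gh e) (w, q) = (0 :: ('a, 'b) lpath \<Rightarrow>\<^sub>0 'k)" if "e \<in> F" for e
        using that * by (cases q) auto
      then have "free_act G (\<Sum>e\<in>F. p * (gen (Ed e) * gen (Gh e))) (Poly_Mapping.single (w, q) 1) = 0"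
        by (simp add: free_act_sum free_act_mult)
      then have "free_act G p (Poly_Mapping.single (w, q) 1) = 0"
        using kill[OF q] by (simp add: free_act_minus)
      then show False
        using path_part_act[OF P w, of q] r by (simp add: p xl in_keys_iff)
    qed
    have out: "out_arcs G w \<subseteq> F"
    proof
      fix e assume e: "e \<in> out_arcs G w"
      then obtain q where "(head G e, q) \<in> paths_to G v" using reach[of "head G e"] by auto
      then have "(w, e # q) \<in> paths_to G v" using e by (auto simp: paths_to_iff)
      from first_arc[OF this] show "e \<in> F" by simp
    qed
    obtain q where q: "(w, q) \<in> paths_to G v" using reach[OF paths_to_end_vert[OF w]] by auto
    then have "hd q \<in> out_arcs G w" using first_arc[OF q] by (cases q) (auto simp: paths_to_iff)
    then have "regular G w"
      using out F(1) paths_to_end_vert[OF w] finite_subset unfolding regular_def by blast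
    from path_elem_regular_end[OF w this F out] show ?thesis by (simp add: xl)
  qed
  have "p - (\<Sum>e\<in>F. p * (gen (Ed e) * gen (Gh e))) =
    (\<Sum>r\<in>Poly_Mapping.keys P. pm_scale (Poly_Mapping.lookup P r)
       (path_elem r - (\<Sum>e\<in>F. path_elem r * (gen (Ed e) * gen (Gh e)))))"
  proof -
    have "(\<Sum>e\<in>F. p * (gen (Ed e) * gen (Gh e))) = (\<Sum>r\<in>Poly_Mapping.keys P. \<Sum>e\<in>F. 
        pm_scale (Poly_Mapping.lookup P r) (path_elem r * (gen (Ed e) * gen (Gh e))))"
      unfolding p lin_ext_def sum_distrib_right by (subst sum.swap) (simp add: pm_scale_mult(1))
    then show ?thesis by (simp add: p lin_ext_def pm_scale_sum sum_subtractf)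
  qed
  also have "\<dots> \<sim> (\<Sum>r\<in>Poly_Mapping.keys P. pm_scale (Poly_Mapping.lookup P r) 0)"
    by (intro lcong_sum lcong_scale local)
  finally show ?thesis by simp
qed

lemma act_cong:
  assumes "is_sink G v" "a \<sim> b" "Poly_Mapping.keys x \<subseteq> paths_to G v"
  shows "free_act G a x = free_act G b x"
  using rel_act[OF wf_digraph_axioms assms(1) _ assms(3), of "a - b"] assms(2)
  by (simp add: lcong_def free_act_minus)

text \<open>
  By induction each \<open>a e\<close> vanishes in \<open>L\<^sub>K(G)\<close>. This expresses the ghost part of \<open>a\<close> through its path
  part \<open>p\<close> and reduces the claim to \<open>annihilating_path_part\<close>; the case \<open>n = 0\<close> is the one with \<open>F\<close>
  empty.
\<close>

lemma ghost_filt_faithful: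
  fixes a :: "('a, 'b, 'k::field) lfree"
  assumes v: "is_sink G v" and reach: "\<And>w. w \<in> verts G \<Longrightarrow> \<exists>q. (w, q) \<in> paths_to G v"
  shows "a \<in> ghost_filt n \<Longrightarrow> (\<And>x. Poly_Mapping.keys x \<subseteq> paths_to G v \<Longrightarrow> free_act G a x = 0) \<Longrightarrow> a \<sim> 0"
proof (induction n arbitrary: a)
  case 0
  then obtain P where P: "Poly_Mapping.keys P \<subseteq> (\<Union>w. paths_to G w)" "a \<sim> lin_ext path_elem P"
    by (auto simp: path_span_def)
  have "free_act G (lin_ext path_elem P) (Poly_Mapping.single r 1) = 0" if "r \<in> paths_to G v" for r
    using 0(2)[of "Poly_Mapping.single r 1"] act_cong[OF v P(2), of "Poly_Mapping.single r 1"] that by simp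
  then have "lin_ext path_elem P \<sim> 0"
    using annihilating_path_part[OF reach P(1), where F = "{}"] by simp
  with P(2) show ?case by (rule lcong_trans)
next
  case (Suc n)
  obtain p F b where p: "p \<in> path_span" and F: "finite F" "F \<subseteq> arcs G" and b: "\<And>e. b e \<in> ghost_filt n"
    "\<And>e. e \<notin> F \<Longrightarrow> b e = 0" and a: "a \<sim> p + (\<Sum>e\<in>F. b e * gen (Gh e))"
    using Suc.prems(1) by auto
  obtain P where P: "Poly_Mapping.keys P \<subseteq> (\<Union>w. paths_to G w)" "p \<sim> lin_ext path_elem P"
    using p by (auto simp: path_span_def)
  define p' where "p' = lin_ext path_elem P"
  note c = path_span_carrier[OF p] ghost_filt_carrier[OF b(1)]
  have be: "b e * gen (Gh e) \<sim> - (p' * (gen (Ed e) * gen (Gh e)))" if "e \<in> F" for e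
  proof -
    have e: "e \<in> arcs G" using that F by auto
    have k: "Poly_Mapping.keys (lin_ext (gen_act G (Ed e)) x) \<subseteq> paths_to G v"
      if "Poly_Mapping.keys x \<subseteq> paths_to G v" for x :: "('a, 'b) lpath \<Rightarrow>\<^sub>0 'k"
      using free_act_closed[OF wf_digraph_axioms gen_in_carrier(2)[OF e] that] by simp
    have "a * gen (Ed e) \<sim> 0"
      by (rule Suc.IH[OF ghost_filt_Ed[OF Suc.prems(1) e]]) (simp add: free_act_mult Suc.prems(2) k)
    with ghost_sum_Ed[OF c(1) F c(2) b(2) a e] have "p * gen (Ed e) + b e * gen (Vx (head G e)) \<sim> 0"
      by (blast intro: lcong_trans lcong_sym)
    from lcong_mult_right[OF gen_in_carrier(3)[OF e] this]
    have 1: "p * (gen (Ed e) * gen (Gh e)) + b e * (gen (Vx (head G e)) * gen (Gh e)) \<sim> 0"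
      by (simp add: distrib_right mult.assoc)
    have 2: "p * (gen (Ed e) * gen (Gh e)) \<sim> p' * (gen (Ed e) * gen (Gh e))"
      using P(2) e unfolding p'_def by (intro lcong_mult_right carrier_intros)
    have "b e * gen (Gh e) = b e * gen (Gh e) - 0" by simp
    also have "\<dots> \<sim> b e * (gen (Vx (head G e)) * gen (Gh e)) -
       (p * (gen (Ed e) * gen (Gh e)) + b e * (gen (Vx (head G e)) * gen (Gh e)))"
      by (intro lcong_minus lcong_sym[OF 1] lcong_mult_left[OF c(2)] lcong_sym[OF lcong_rels(4)] e)
    also have "\<dots> = 0 - p * (gen (Ed e) * gen (Gh e))" by simp
    also have "\<dots> \<sim> 0 - p' * (gen (Ed e) * gen (Gh e))"
      by (intro lcong_minus 2 lcong_refl free_alg_closed)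
    finally show ?thesis by simp
  qed
  have "p + (\<Sum>e\<in>F. b e * gen (Gh e)) \<sim> p' + (\<Sum>e\<in>F. - (p' * (gen (Ed e) * gen (Gh e))))"
    unfolding p'_def[symmetric]
    by (intro lcong_add lcong_sum) (use P(2) be in \<open>auto simp: p'_def\<close>)
  from lcong_trans[OF a this]
  have ap: "a \<sim> p' - (\<Sum>e\<in>F. p' * (gen (Ed e) * gen (Gh e)))" by (simp add: sum_negf)
  have "free_act G (p' - (\<Sum>e\<in>F. p' * (gen (Ed e) * gen (Gh e)))) (Poly_Mapping.single r 1) = 0"
    if "r \<in> paths_to G v" for r
    using act_cong[OF v ap, of "Poly_Mapping.single r 1"] Suc.prems(2)[of "Poly_Mapping.single r 1"] that by simp
  from annihilating_path_part[OF reach P(1) F p'_def this] ap show ?case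
    by (blast intro: lcong_trans)
qed

lemma sink_module_faithful:
  fixes a :: "('a, 'b, 'k::field) lfree"
  assumes "is_sink G v" "\<And>w. w \<in> verts G \<Longrightarrow> \<exists>q. (w, q) \<in> paths_to G v"
    and "a \<in> lfree_carrier" "\<And>x. Poly_Mapping.keys x \<subseteq> paths_to G v \<Longrightarrow> free_act G a x = 0"
  shows "a \<in> rel_ideal G"
  using ghost_filt_faithful[OF assms(1,2) _ assms(4)] ghost_filt_exhausts[OF assms(3)] by (auto simp: lcong_0_iff)

end

section \<open>The quotient graph\<close>

lemma quot_graph_out_arcs: "out_arcs (quot_graph E H) u = out_arcs_off E H u"
  by (auto simp: out_arcs_off_def out_arcs_def)

lemma quot_graph_regular:
  "regular (quot_graph E H) u \<longleftrightarrow> u \<in> verts E \<and> u \<notin> H \<and> finite (out_arcs_off E H u) \<and> out_arcs_off E H u \<noteq> {}"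
  by (auto simp: regular_def quot_graph_out_arcs)

lemma quot_gen_carrier:
  "g \<in> lgens E \<Longrightarrow> quot_gen E H g \<in> carrier (free_alg (lgens (quot_graph E H)))"
  by (cases g) (auto simp: gen_carrier free_alg_closed)

lemma free_lift_carrier:
  assumes a: "a \<in> carrier (free_alg X)" and f: "\<And>g. g \<in> X \<Longrightarrow> f g \<in> carrier (free_alg Y)"
  shows "free_lift f a \<in> carrier (free_alg Y)"
proof -
  have "prod_list (map f l) \<in> carrier (free_alg Y)" if "l \<noteq> []" "set l \<subseteq> X" for l
    using that by (induction l rule: list_nonempty_induct) (auto intro: f free_alg_closed)
  then show ?thesis
    using a unfolding free_lift_def lin_ext_def
    by (intro free_alg_sum free_alg_closed(5)) (auto simp: free_alg_carrier[of a])
qed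

lemma alg_idealD:
  assumes "alg_ideal A I"
  shows "I \<subseteq> carrier A" "\<zero>\<^bsub>A\<^esub> \<in> I" "x \<in> I \<Longrightarrow> y \<in> I \<Longrightarrow> x \<oplus>\<^bsub>A\<^esub> y \<in> I" "x \<in> I \<Longrightarrow> c \<odot>\<^bsub>A\<^esub> x \<in> I"
    "x \<in> I \<Longrightarrow> a \<in> carrier A \<Longrightarrow> a \<otimes>\<^bsub>A\<^esub> x \<in> I" "x \<in> I \<Longrightarrow> a \<in> carrier A \<Longrightarrow> x \<otimes>\<^bsub>A\<^esub> a \<in> I"
  using assms by (auto simp: alg_ideal_def)

lemma free_ideal_minus:
  "alg_ideal (free_alg X) J \<Longrightarrow> a \<in> J \<Longrightarrow> b \<in> J \<Longrightarrow> a - b \<in> J"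
  using alg_idealD(3)[of "free_alg X" J a "pm_scale (-1) b"] alg_idealD(4)[of "free_alg X" J b "-1"]
  by (simp add: pm_scale_minus1)

lemma free_ideal_sum:
  "alg_ideal (free_alg X) J \<Longrightarrow> (\<And>i. i \<in> S \<Longrightarrow> f i \<in> J) \<Longrightarrow> (\<Sum>i\<in>S. f i) \<in> J"
  using alg_idealD(2)[of "free_alg X" J] alg_idealD(3)[of "free_alg X" J]
  by (induction S rule: infinite_finite_induct) auto

text \<open>
  The ideal \<open>J\<close> of the free algebra stands for the preimage of an ideal of \<open>L\<^sub>K(E)\<close>. It contains every
  generator that \<open>quot_gen\<close> kills, since \<open>e = e r(e)\<close> and \<open>e\<^sup>* = r(e) e\<^sup>*\<close>, so each element is
  congruent modulo \<open>J\<close> to its image under the quotient map; and it contains the relations of the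
  quotient graph.
\<close>

lemma ideal_contains_quot_kernel:
  fixes E :: "('v, 'e) pre_digraph" and J :: "('v, 'e, 'k::field) lfree set"
  assumes E: "wf_digraph E" and H: "hereditary E H"
    and J: "alg_ideal (free_alg (lgens E)) J" "rel_ideal E \<subseteq> J"
    and JH: "\<And>u. u \<in> H \<Longrightarrow> gen (Vx u) \<in> J" and JB: "\<And>u. u \<in> breaking E H \<Longrightarrow> gap_elem E H u \<in> J"
    and a: "a \<in> carrier (free_alg (lgens E))"
    and fa: "free_lift (quot_gen E H) a \<in> rel_ideal (quot_graph E H)"
  shows "a \<in> J"
proof -
  interpret wf_digraph E by fact
  let ?G = "quot_graph E H"
  note JD = alg_idealD[OF J(1), simplified] and Jm = free_ideal_minus[OF J(1)] and Js = free_ideal_sum[OF J(1)]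
  have cong: "x \<in> J" if "y \<in> J" "y - x \<in> rel_ideal E" for x y
    using Jm[OF that(1) subsetD[OF J(2) that(2)]] by simp
  have JE: "gen (Ed e) \<in> J" if "e \<in> arcs E" "head E e \<in> H" for e
    by (rule cong[OF _ rel_ideal_rels(3)]) (use that in \<open>auto intro!: JD(5) JH simp: gen_carrier\<close>)
  have JG: "gen (Gh e) \<in> J" if "e \<in> arcs E" "head E e \<in> H" for e
    by (rule cong[OF _ rel_ideal_rels(4)]) (use that in \<open>auto intro!: JD(6) JH simp: gen_carrier\<close>)
  have gen_diff: "gen g - quot_gen E H g \<in> J" if "g \<in> lgens E" for g
    using that JD(2) by (auto simp: lgens_def intro: JH JE JG)
  have sub: "lgens ?G \<subseteq> lgens E" by (auto simp: lgens_def)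
  have cs: "x \<in> carrier (free_alg (lgens E))" if "x \<in> carrier (free_alg (lgens ?G))" for x :: "('v, 'e, 'k) lfree"
    using that sub by (auto simp: free_alg_carrier)
  have word_diff: "prod_list (map gen l) - prod_list (map (quot_gen E H) l) \<in> J \<and>
      prod_list (map gen l) \<in> (carrier (free_alg (lgens E)) :: ('v, 'e, 'k) lfree set) \<and>
      prod_list (map (quot_gen E H) l) \<in> (carrier (free_alg (lgens E)) :: ('v, 'e, 'k) lfree set)"
    if "l \<noteq> []" "set l \<subseteq> lgens E" for l
    using that
  proof (induction l rule: list_nonempty_induct)
    case (single g)
    then show ?case using gen_diff[of g] cs[OF quot_gen_carrier[of g E H]] by (simp add: gen_carrier)
  next
    case (cons g l)
    let ?a = "prod_list (map gen l) :: ('v, 'e, 'k) lfree" and ?b = "prod_list (map (quot_gen E H) l) :: ('v, 'e, 'k) lfree"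
    have IH: "?a - ?b \<in> J" "?a \<in> carrier (free_alg (lgens E))" "?b \<in> carrier (free_alg (lgens E))"
      and g: "g \<in> lgens E" using cons by auto
    have "gen g * ?a - quot_gen E H g * ?b = (gen g - quot_gen E H g) * ?a + quot_gen E H g * (?a - ?b)"
      by (simp add: algebra_simps)
    also have "\<dots> \<in> J"
      using IH gen_diff[OF g] cs[OF quot_gen_carrier[OF g, of H]] by (intro JD(3) JD(5) JD(6))
    finally show ?case
      using IH g cs[OF quot_gen_carrier[OF g, of H]] by (auto intro!: free_alg_closed simp: gen_carrier)
  qed
  have prod_gen: "prod_list (map gen l) = Poly_Mapping.single (Word l) (1::'k)" for l :: "('v, 'e) lgen list"
    by (induction l) (simp_all add: gen_def mult_single plus_word_def flip: zero_word_def single_one)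
  have diff: "a - free_lift (quot_gen E H) a \<in> J"
  proof -
    have "a - free_lift (quot_gen E H) a = (\<Sum>w\<in>Poly_Mapping.keys a. pm_scale (Poly_Mapping.lookup a w)
       (prod_list (map gen (letters w)) - prod_list (map (quot_gen E H) (letters w))))"
      by (simp add: free_lift_def lin_ext_def prod_gen sum_subtractf flip: pm_expand)
    also have "\<dots> \<in> J"
      using a word_diff by (intro Js JD(4)) (auto simp: free_alg_carrier)
    finally show ?thesis .
  qed
  have "alg_ideal (free_alg (lgens ?G)) (J \<inter> carrier (free_alg (lgens ?G)))"
    unfolding alg_ideal_def using JD cs by (auto intro: free_alg_closed)
  moreover have "r \<in> J" if "r \<in> lrels ?G" for r
    using that unfolding lrels_def
  proof (elim UnE CollectE exE conjE, goal_cases)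
    case (7 u)
    have u: "u \<in> verts E" "u \<notin> H" and o: "finite (out_arcs_off E H u)" "out_arcs_off E H u \<noteq> {}"
      using 7 by (auto simp: quot_graph_regular)
    \<comment> \<open>A regular vertex of the quotient graph is regular in \<open>E\<close> or a breaking vertex.\<close>
    show ?case
    proof (cases "finite (out_arcs E u)")
      case True
      then have r: "regular E u" using u o by (auto simp: regular_def out_arcs_off_def)
      have "gen (Vx u) - (\<Sum>e\<in>out_arcs E u. gen (Ed e) * gen (Gh e)) +
          (\<Sum>e\<in>out_arcs E u - out_arcs_off E H u. gen (Ed e) * gen (Gh e)) \<in> J"
        by (intro JD(3) Js subsetD[OF J(2) rel_ideal_rels(7)[OF r]] JD(6) JE)
           (auto simp: out_arcs_off_def gen_carrier)
      moreover have "(\<Sum>e\<in>out_arcs E u. gen (Ed e) * gen (Gh e)) =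
          (\<Sum>e\<in>out_arcs E u - out_arcs_off E H u. gen (Ed e) * gen (Gh e)) +
          (\<Sum>e\<in>out_arcs_off E H u. gen (Ed e) * gen (Gh e) :: ('v, 'e, 'k) lfree)"
        using True by (intro sum.subset_diff) (auto simp: out_arcs_off_def)
      ultimately show ?thesis using 7 by (simp add: quot_graph_out_arcs)
    next
      case False
      then have "u \<in> breaking E H" using u o by (auto simp: breaking_def infinite_emitter_def)
      then show ?thesis using JB 7 by (simp add: gap_elem_def quot_graph_out_arcs)
    qed
  next
    case (1 u w)
    then show ?case using subsetD[OF J(2) rel_ideal_rels(1)[of u E w]] by simp
  next
    case (2 e)
    then show ?case using subsetD[OF J(2) rel_ideal_rels(2)[of e E]] by simp
  next
    case (3 e)
    then show ?case using subsetD[OF J(2) rel_ideal_rels(3)[of e E]] by simp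
  next
    case (4 e)
    then show ?case using subsetD[OF J(2) rel_ideal_rels(4)[of e E]] by simp
  next
    case (5 e)
    then show ?case using subsetD[OF J(2) rel_ideal_rels(5)[of e E]] by simp
  next
    case (6 e f)
    then show ?case using subsetD[OF J(2) rel_ideal_rels(6)[of e E f]] by (auto split: if_splits)
  qed
  ultimately have "rel_ideal ?G \<subseteq> J"
    using alg_ideal_gen_least lrels_carrier[OF quot_graph_wf[OF E H]] unfolding rel_ideal_def by blast
  then show ?thesis using JD(3)[OF diff subsetD[OF _ fa]] by simp
qed

text \<open>
  All vertices on a path to \<open>v\<close> connect to \<open>v\<close> and hence survive in the quotient graph.
\<close>

lemma paths_to_quot_graph:
  assumes "wf_digraph E" "(u, p) \<in> paths_to E v"
  shows "(u, p) \<in> paths_to (quot_graph E (H_of E v)) v"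
  using assms(2)
proof (induction p arbitrary: u)
  case Nil
  then have "connects E u v" by (auto simp: connects_def paths_to_def)
  with Nil show ?case by (auto simp: paths_to_Nil H_of_def)
next
  case (Cons e p)
  then have "(head E e, p) \<in> paths_to E v" by (simp add: paths_to_Cons[OF assms(1)])
  then have "connects E (head E e) v" by (auto simp: connects_def paths_to_def)
  then have "head E e \<notin> H_of E v" by (simp add: H_of_def)
  then show ?case
    using Cons by (auto simp: paths_to_Cons[OF assms(1)]
        paths_to_Cons[OF quot_graph_wf[OF assms(1) H_of_hereditary[OF assms(1)]]])
qed

section \<open>Ideals of the Leavitt path algebra\<close>

lemma I_ideal_least:
  "alg_ideal (leavitt E) I \<Longrightarrow> (\<And>u. u \<in> H \<Longrightarrow> lcls E (gen (Vx u)) \<in> I) \<Longrightarrow>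
    (\<And>u. u \<in> B \<Longrightarrow> lcls E (gap_elem E H u) \<in> I) \<Longrightarrow> I_ideal E H B \<subseteq> I"
  unfolding I_ideal_def by (rule alg_ideal_gen_least) auto

lemma leavitt_zero: "\<zero>\<^bsub>leavitt E\<^esub> = lcls E 0"
  by (simp add: leavitt_def alg_quot_def lcls_eq)

lemma leavitt_ideal_preimage:
  fixes I :: "('v, 'e, 'k::field) lfree set set"
  assumes E: "wf_digraph E" and I: "alg_ideal (leavitt E) I"
  shows "alg_ideal (free_alg (lgens E)) {a \<in> carrier (free_alg (lgens E)). lcls E a \<in> I}"
proof -
  note ID = alg_idealD[OF I] and ops = leavitt_ops[OF E]
  have z: "lcls E 0 \<in> I" using ID(2) by (simp add: leavitt_zero)
  have "lcls E (a + b) \<in> I" if "a \<in> carrier (free_alg (lgens E))" "lcls E a \<in> I"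
    "b \<in> carrier (free_alg (lgens E))" "lcls E b \<in> I" for a b :: "('v, 'e, 'k) lfree"
    using ID(3)[OF that(2,4)] ops(1)[OF that(1,3)] by simp
  moreover have "lcls E (pm_scale c a) \<in> I" if "a \<in> carrier (free_alg (lgens E))" "lcls E a \<in> I"
    for c and a :: "('v, 'e, 'k) lfree"
    using ID(4)[OF that(2), of c] ops(3)[OF that(1,1), of c] by simp
  moreover have "lcls E (a * b) \<in> I" "lcls E (b * a) \<in> I" if "a \<in> carrier (free_alg (lgens E))"
    "b \<in> carrier (free_alg (lgens E))" "lcls E b \<in> I" for a b :: "('v, 'e, 'k) lfree"
    using that ID(5,6)[of "lcls E b" "lcls E a"] ops(2)[OF that(1,2)] ops(2)[OF that(2,1)]
    by (auto simp: leavitt_carrier)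
  ultimately show ?thesis by (simp add: alg_ideal_def z free_alg_closed)
qed

theorem lemma3p6:
  fixes E :: "('v, 'e) pre_digraph" and v :: 'v
  assumes "wf_digraph E"
    and "infinite_emitter E v"
    and "head E ` out_arcs E v \<subseteq> H_of E v"
  shows "annihilator (leavitt E :: ('k::field, ('v, 'e, 'k) lfree set) module) (NH_mod E v)
       = I_ideal E (H_of E v) (breaking E (H_of E v))"
proof -
  let ?H = "H_of E v" and ?B = "breaking E (H_of E v)"
  let ?G = "quot_graph E ?H" and ?R = "carrier (free_alg (lgens E)) :: ('v, 'e, 'k) lfree set"
  let ?f = "free_lift (quot_gen E ?H) :: ('v, 'e, 'k) lfree \<Rightarrow> _"
  let ?N = "{x :: ('v, 'e) lpath \<Rightarrow>\<^sub>0 'k. Poly_Mapping.keys x \<subseteq> paths_to ?G v}"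
  let ?L = "leavitt E :: ('k, ('v, 'e, 'k) lfree set) module"
  let ?Ann = "annihilator ?L (NH_mod E v)"
  note E = assms(1)
  note H = H_of_hereditary[OF E, of v] H_of_saturated[OF E assms(2)]
  note G = quot_graph_wf[OF E H(1)] and sink = v_sink[OF assms]
  note ops = leavitt_ops[OF E]
  have N: "carrier (NH_mod E v) = ?N" "\<zero>\<^bsub>NH_mod E v\<^esub> = 0"
    by (simp_all add: NH_mod_def restrict_scalars_def N_mod_def)
  have fR: "?f a \<in> carrier (free_alg (lgens ?G))" if "a \<in> ?R" for a
    by (rule free_lift_carrier[OF that quot_gen_carrier])
  have Ann_iff: "lcls E a \<in> ?Ann \<longleftrightarrow> (\<forall>x\<in>?N. free_act ?G (?f a) x = 0)" if "a \<in> ?R" for a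
    using that NH_mod_act[OF assms, of _ a] by (auto simp: annihilator_def leavitt_carrier N)
  have Ann_ex: "\<exists>a\<in>?R. X = lcls E a \<and> (\<forall>x\<in>?N. free_act ?G (?f a) x = 0)" if "X \<in> ?Ann" for X
    using that Ann_iff by (auto simp: annihilator_def leavitt_carrier)
  show ?thesis
  proof (rule subset_antisym)
    show "?Ann \<subseteq> I_ideal E ?H ?B"
    proof
      fix X assume "X \<in> ?Ann"
      then obtain a where a: "a \<in> ?R" "X = lcls E a" "\<forall>x\<in>?N. free_act ?G (?f a) x = 0"
        using Ann_ex by blast
      have "\<exists>q. (w, q) \<in> paths_to ?G v" if "w \<in> verts ?G" for w
        using that paths_to_quot_graph[OF E, of w _ v] by (auto simp: H_of_def connects_def paths_to_def)
      with a(3) have fa: "?f a \<in> rel_ideal ?G"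
        by (intro wf_digraph.sink_module_faithful[OF G sink _ fR[OF a(1)]]) auto
      have "X \<in> I" if I: "alg_ideal ?L I" "(\<lambda>u. lcls E (gen (Vx u))) ` ?H \<union> (\<lambda>u. lcls E (gap_elem E ?H u)) ` ?B \<subseteq> I" for I
      proof -
        have gap: "gap_elem E ?H u \<in> ?R" if "u \<in> ?B" for u
          using that by (auto simp: gap_elem_def breaking_def out_arcs_off_def gen_carrier
              intro!: free_alg_closed free_alg_sum)
        have "lcls E r \<in> I" if "r \<in> rel_ideal E" for r
        proof -
          have "lcls E r = lcls E 0" using that by (simp add: lcls_eq_iff[OF E])
          then show ?thesis using alg_idealD(2)[OF I(1)] by (simp add: leavitt_zero)
        qed
        then have "a \<in> {a \<in> ?R. lcls E a \<in> I}"
          using I(2) gap rel_idealD(7)[OF E]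
          by (intro ideal_contains_quot_kernel[OF E H(1) leavitt_ideal_preimage[OF E I(1)] _ _ _ a(1) fa])
             (auto simp: gen_carrier H_of_def)
        then show ?thesis using a(2) by simp
      qed
      then show "X \<in> I_ideal E ?H ?B" by (auto simp: I_ideal_def alg_ideal_gen_def)
    qed
  next
    have "alg_ideal ?L ?Ann"
      unfolding alg_ideal_def
    proof (intro conjI ballI allI)
      show "?Ann \<subseteq> carrier ?L" by (auto simp: annihilator_def)
      show "\<zero>\<^bsub>?L\<^esub> \<in> ?Ann" using Ann_iff[of 0] by (simp add: leavitt_zero free_alg_closed)
    next
      fix X Y assume X: "X \<in> ?Ann" and Y: "Y \<in> ?Ann"
      from Ann_ex[OF X] Ann_ex[OF Y] show "X \<oplus>\<^bsub>?L\<^esub> Y \<in> ?Ann"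
        by (auto simp: ops(1) Ann_iff free_alg_closed free_lift_add free_act_add)
    next
      fix c X assume "X \<in> ?Ann"
      from Ann_ex[OF this] show "c \<odot>\<^bsub>?L\<^esub> X \<in> ?Ann"
        by (auto simp: ops(3) Ann_iff free_alg_closed free_lift_scale free_act_scale)
    next
      fix A X assume "A \<in> carrier ?L" and X: "X \<in> ?Ann"
      then obtain b where b: "b \<in> ?R" "A = lcls E b" by (auto simp: leavitt_carrier)
      obtain a where a: "a \<in> ?R" "X = lcls E a" "\<forall>x\<in>?N. free_act ?G (?f a) x = 0"
        using Ann_ex[OF X] by blast
      have "free_act ?G (?f b) x \<in> ?N" if "x \<in> ?N" for x
        using free_act_closed[OF G fR[OF b(1)], of x] that by auto
      then show "A \<otimes>\<^bsub>?L\<^esub> X \<in> ?Ann" "X \<otimes>\<^bsub>?L\<^esub> A \<in> ?Ann"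
        using a b by (simp_all add: ops(2) Ann_iff free_alg_closed free_lift_mult free_act_mult)
    qed
    moreover have "lcls E (gen (Vx u)) \<in> ?Ann" if "u \<in> ?H" for u
      using that by (subst Ann_iff) (auto simp: gen_carrier H_of_def)
    moreover have "lcls E (gap_elem E ?H u) \<in> ?Ann" if u: "u \<in> ?B" for u
    proof -
      have gap: "gap_elem E ?H u \<in> ?R"
        using u by (auto simp: gap_elem_def breaking_def out_arcs_off_def gen_carrier
            intro!: free_alg_closed free_alg_sum)
      have r: "regular ?G u" using u by (auto simp: quot_graph_regular breaking_def)
      have "?f (gap_elem E ?H u) = gen (Vx u) - (\<Sum>e\<in>out_arcs ?G u. gen (Ed e) * gen (Gh e))"
        using u unfolding quot_graph_out_arcs
        by (auto simp: gap_elem_def free_lift_minus free_lift_sum free_lift_mult out_arcs_off_def breaking_def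
            intro!: sum.cong)
      then have "free_act ?G (?f (gap_elem E ?H u)) x = 0" if "x \<in> ?N" for x
        using that by (simp only: mem_Collect_eq rel_act[OF G sink rel_ideal_rels(7)[OF r]])
      then show ?thesis unfolding Ann_iff[OF gap] by blast
    qed
    ultimately show "I_ideal E ?H ?B \<subseteq> ?Ann" by (rule I_ideal_least)
  qed
qed

end
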